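(* Let $\mathfrak{g}$ be a finite dimensional Lie algebra over a field of characteristic zero and let $V$ be a finite dimensional representation of $\mathfrak{g}$. Then the diagram formed by the maps $\mathrm{PBW}:(S\mathfrak{g})^{\mathfrak{g}}\to(U\mathfrak{g})^{\mathfrak{g}}$, the action map $(U\mathfrak{g})^{\mathfrak{g}}\to\mathrm{Hom}(V,V)$, and the contraction map $(S\mathfrak{g})^{\mathfrak{g}}\to\mathrm{Hom}(V,V)$, $s\mapsto s\lrcorner\exp(\Lambda)$, is commutative; that is, for every $s\in(S\mathfrak{g})^{\mathfrak{g}}$ the endomorphism of $V$ by which $\mathrm{PBW}(s)\in U\mathfrak{g}$ acts equals $s\lrcorner\exp(\Lambda)$.
   Context: $S\mathfrak{g}$ is the symmetric algebra and $U\mathfrak{g}$ the universal enveloping algebra of $\mathfrak{g}$; $(-)^{\mathfrak{g}}$ denotes $\mathfrak{g}$-invariants (for the actions induced by the adjoint action). The map $\mathrm{PBW}:S\mathfrak{g}\to U\mathfrak{g}$ is given in degree $n$ by $x_1\cdots x_n\mapsto\frac1{n!}\sum_{\sigma\in S_n}x_{\sigma(1)}\cdots x_{\sigma(n)}$. The action map $U\mathfrak{g}\to\mathrm{Hom}(V,V)$ is the natural action of $U\mathfrak{g}$ on $V$. The representation map $\mathfrak{g}\otimes V\to V$ is rewritten by adjunction as $\Lambda:V\to V\otimes\mathfrak{g}^*$. Set $\exp(\Lambda)=\mathrm{id}_V+\Lambda+\cdots+\frac{\Lambda^k}{k!}+\cdots$, where $\Lambda^k:V\to V\otimes S^k\mathfrak{g}^*$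 is the $k$-fold iterate of $\Lambda$ with the $\mathfrak{g}^*$-factors multiplied in the symmetric algebra. An element $s\in S^k\mathfrak{g}$ is contracted with the term $\frac{\Lambda^k}{k!}$ using the pairing $\langle\xi_1\cdots\xi_k,x_1\cdots x_k\rangle=\sum_{\sigma\in S_k}\prod_i\xi_i(x_{\sigma(i)})$ between $S^k\mathfrak{g}^*$ and $S^k\mathfrak{g}$, giving $s\lrcorner\exp(\Lambda)\in\mathrm{Hom}(V,V)$; this is extended linearly to $S\mathfrak{g}$. *)

theory Defs
  imports
    Complex_Main
    "HOL-Library.Poly_Mapping"
    "HOL-Library.Set_Algebras"
    "HOL-Library.Function_Algebras"
    "HOL-Library.Groups_Big_Fun"
    "HOL-Library.FuncSet"
    "HOL-Combinatorics.Permutations"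
begin

section \<open>Lie algebras and representations\<close>

locale lie_algebra = finite_dimensional_vector_space scaleG BasisG
  for scaleG :: "'k::field_char_0 \<Rightarrow> 'g::ab_group_add \<Rightarrow> 'g" and BasisG :: "'g set" +
  fixes bracket :: "'g \<Rightarrow> 'g \<Rightarrow> 'g"
  assumes bracket_linear_left: "Vector_Spaces.linear scaleG scaleG (\<lambda>x. bracket x y)"
    and bracket_linear_right: "Vector_Spaces.linear scaleG scaleG (bracket x)"
    and bracket_self: "bracket x x = 0"
    and jacobi: "bracket x (bracket y z) + bracket y (bracket z x) + bracket z (bracket x y) = 0"

locale lie_representation =
  lie_algebra scaleG BasisG bracket + V: finite_dimensional_vector_space scaleV BasisV
  for scaleG :: "'k::field_char_0 \<Rightarrow> 'g::ab_group_add \<Rightarrow> 'g" and BasisG bracket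
    and scaleV :: "'k \<Rightarrow> 'v::ab_group_add \<Rightarrow> 'v" and BasisV +
  fixes rho :: "'g \<Rightarrow> 'v \<Rightarrow> 'v"
  assumes rho_linear_left: "Vector_Spaces.linear scaleG scaleV (\<lambda>x. rho x v)"
    and rho_linear_right: "Vector_Spaces.linear scaleV scaleV (rho x)"
    and rho_bracket: "rho (bracket x y) v = rho x (rho y v) - rho y (rho x v)"


section \<open>Free vector spaces and their quotients\<close>

text \<open>
  The free vector space on a type \<open>'a\<close> is \<open>'a \<Rightarrow>\<^sub>0 'k\<close>. Elements of a quotient by a subspace \<open>N\<close> are
  the cosets \<open>p +o N\<close>; the sum of two cosets is the setwise sum \<open>X + Y\<close>, and the zero of the
  quotient is \<open>0 +o N\<close>.
\<close>

definition pscale :: "'k::field \<Rightarrow> ('a \<Rightarrow>\<^sub>0 'k) \<Rightarrow> ('a \<Rightarrow>\<^sub>0 'k)"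
  where "pscale c p = Poly_Mapping.map ((*) c) p"

definition lin_ext ::
    "('k::field \<Rightarrow> 'b::ab_group_add \<Rightarrow> 'b) \<Rightarrow> ('a \<Rightarrow> 'b) \<Rightarrow> ('a \<Rightarrow>\<^sub>0 'k) \<Rightarrow> 'b"
  where "lin_ext scale f p = (\<Sum>a\<in>Poly_Mapping.keys p. scale (Poly_Mapping.lookup p a) (f a))"

definition free_on :: "'a set \<Rightarrow> ('a \<Rightarrow>\<^sub>0 'k::field) set"
  where "free_on A = {p. Poly_Mapping.keys p \<subseteq> A}"

text \<open>The value on a coset \<open>X\<close> of a function that is constant on cosets.\<close>

definition induced :: "('a \<Rightarrow> 'b) \<Rightarrow> 'a set \<Rightarrow> 'b"
  where "induced f X = the_elem (f ` X)"

definition induced2 :: "('a \<Rightarrow> 'b \<Rightarrow> 'c) \<Rightarrow> 'a set \<Rightarrow> 'b set \<Rightarrow> 'c"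
  where "induced2 f X Y = the_elem ((\<lambda>(x, y). f x y) ` (X \<times> Y))"

definition qscale :: "('a \<Rightarrow>\<^sub>0 'k::field) set \<Rightarrow> 'k \<Rightarrow> ('a \<Rightarrow>\<^sub>0 'k) set \<Rightarrow> ('a \<Rightarrow>\<^sub>0 'k) set"
  where "qscale N c = induced (\<lambda>p. pscale c p +o N)"

text \<open>
  Linear extension to \<open>'a \<Rightarrow>\<^sub>0 'k\<close> of a map \<open>F\<close> with values in the quotient by \<open>N\<close>; the summand \<open>N\<close>
  is needed because the empty sum of sets is \<open>{0}\<close>.
\<close>

definition quot_lin_ext ::
    "('b \<Rightarrow>\<^sub>0 'k::field) set \<Rightarrow> ('a \<Rightarrow> ('b \<Rightarrow>\<^sub>0 'k) set) \<Rightarrow> ('a \<Rightarrow>\<^sub>0 'k) \<Rightarrow> ('b \<Rightarrow>\<^sub>0 'k) set"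
  where "quot_lin_ext N F p =
    N + (\<Sum>a\<in>Poly_Mapping.keys p. qscale N (Poly_Mapping.lookup p a) (F a))"


section \<open>Symmetric and universal enveloping algebras\<close>

text \<open>
  Lists under concatenation are the free monoid, so \<open>'a list \<Rightarrow>\<^sub>0 'k\<close> is the free associative unital
  algebra on \<open>'a\<close>, with the multiplication provided by \<open>Poly_Mapping\<close>.
\<close>

instantiation list :: (type) monoid_add
begin
definition zero_list :: "'a list" where "0 = []"
definition plus_list :: "'a list \<Rightarrow> 'a list \<Rightarrow> 'a list" where "xs + ys = xs @ ys"
instance by standard (simp_all add: zero_list_def plus_list_def)
end

definition letter :: "'a \<Rightarrow> 'a list \<Rightarrow>\<^sub>0 'k::field"
  where "letter x = Poly_Mapping.single [x] 1"

text \<open>The two-sided ideal of the free algebra on \<open>W\<close> generated by \<open>R\<close>.\<close>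

definition two_sided_ideal :: "'w set \<Rightarrow> ('w list \<Rightarrow>\<^sub>0 'k::field) set \<Rightarrow> ('w list \<Rightarrow>\<^sub>0 'k) set"
  where "two_sided_ideal W R = module.span pscale
    {Poly_Mapping.single u 1 * r * Poly_Mapping.single v 1 | u r v. u \<in> lists W \<and> r \<in> R \<and> v \<in> lists W}"

text \<open>Dividing the free algebra on \<open>W\<close> by the linear relators alone gives the tensor algebra of \<open>W\<close>.\<close>

definition linear_relators ::
    "('k::field \<Rightarrow> 'w::ab_group_add \<Rightarrow> 'w) \<Rightarrow> 'w set \<Rightarrow> ('w list \<Rightarrow>\<^sub>0 'k) set"
  where "linear_relators scale W =
    {letter (x + y) - letter x - letter y | x y. x \<in> W \<and> y \<in> W} \<union>
    {letter (scale c x) - pscale c (letter x) | c x. x \<in> W}"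

definition sym_ideal ::
    "('k::field \<Rightarrow> 'w::ab_group_add \<Rightarrow> 'w) \<Rightarrow> 'w set \<Rightarrow> ('w list \<Rightarrow>\<^sub>0 'k) set"
  where "sym_ideal scale W = two_sided_ideal W (linear_relators scale W \<union>
    {letter x * letter y - letter y * letter x | x y. x \<in> W \<and> y \<in> W})"

definition sym_alg ::
    "('k::field \<Rightarrow> 'w::ab_group_add \<Rightarrow> 'w) \<Rightarrow> 'w set \<Rightarrow> ('w list \<Rightarrow>\<^sub>0 'k) set set"
  where "sym_alg scale W = (\<lambda>p. p +o sym_ideal scale W) ` free_on (lists W)"

definition env_ideal ::
    "('k::field \<Rightarrow> 'g::ab_group_add \<Rightarrow> 'g) \<Rightarrow> ('g \<Rightarrow> 'g \<Rightarrow> 'g) \<Rightarrow> ('g list \<Rightarrow>\<^sub>0 'k) set"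
  where "env_ideal scale bracket = two_sided_ideal UNIV (linear_relators scale UNIV \<union>
    {letter x * letter y - letter y * letter x - letter (bracket x y) | x y. True})"

definition env_alg ::
    "('k::field \<Rightarrow> 'g::ab_group_add \<Rightarrow> 'g) \<Rightarrow> ('g \<Rightarrow> 'g \<Rightarrow> 'g) \<Rightarrow> ('g list \<Rightarrow>\<^sub>0 'k) set set"
  where "env_alg scale bracket = range (\<lambda>p. p +o env_ideal scale bracket)"

definition quot_mult ::
    "('a list \<Rightarrow>\<^sub>0 'k::field) set \<Rightarrow> ('a list \<Rightarrow>\<^sub>0 'k) set \<Rightarrow> ('a list \<Rightarrow>\<^sub>0 'k) set \<Rightarrow> ('a list \<Rightarrow>\<^sub>0 'k) set"
  where "quot_mult N = induced2 (\<lambda>p q. (p * q) +o N)"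

text \<open>
  The action of \<open>x\<close> on a quotient of the free algebra by the derivation extending \<open>ad x\<close>:
  \<open>x\<^sub>1 \<cdots> x\<^sub>n\<close> goes to the sum over \<open>i\<close> of \<open>x\<^sub>1 \<cdots> [x, x\<^sub>i] \<cdots> x\<^sub>n\<close>.
\<close>

definition ad_word :: "('g \<Rightarrow> 'g \<Rightarrow> 'g) \<Rightarrow> 'g \<Rightarrow> 'g list \<Rightarrow> 'g list \<Rightarrow>\<^sub>0 'k::field"
  where "ad_word bracket x w = (\<Sum>i<length w. Poly_Mapping.single (w[i := bracket x (w ! i)]) 1)"

definition ad_action ::
    "('g list \<Rightarrow>\<^sub>0 'k::field) set \<Rightarrow> ('g \<Rightarrow> 'g \<Rightarrow> 'g) \<Rightarrow> 'g \<Rightarrow> ('g list \<Rightarrow>\<^sub>0 'k) set \<Rightarrow> ('g list \<Rightarrow>\<^sub>0 'k) set"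
  where "ad_action N bracket x = induced (\<lambda>p. lin_ext pscale (ad_word bracket x) p +o N)"

definition sym_invariants ::
    "('k::field \<Rightarrow> 'g::ab_group_add \<Rightarrow> 'g) \<Rightarrow> ('g \<Rightarrow> 'g \<Rightarrow> 'g) \<Rightarrow> ('g list \<Rightarrow>\<^sub>0 'k) set set"
  where "sym_invariants scale bracket = {s \<in> sym_alg scale UNIV.
    \<forall>x. ad_action (sym_ideal scale UNIV) bracket x s = 0 +o sym_ideal scale UNIV}"

definition env_invariants ::
    "('k::field \<Rightarrow> 'g::ab_group_add \<Rightarrow> 'g) \<Rightarrow> ('g \<Rightarrow> 'g \<Rightarrow> 'g) \<Rightarrow> ('g list \<Rightarrow>\<^sub>0 'k) set set"
  where "env_invariants scale bracket = {u \<in> env_alg scale bracket.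
    \<forall>x. ad_action (env_ideal scale bracket) bracket x u = 0 +o env_ideal scale bracket}"

definition symmetrize :: "'g list \<Rightarrow> 'g list \<Rightarrow>\<^sub>0 'k::field_char_0"
  where "symmetrize w = pscale (1 / fact (length w))
    (\<Sum>\<sigma> | \<sigma> permutes {..<length w}. Poly_Mapping.single (permute_list \<sigma> w) 1)"

definition PBW ::
    "('k::field_char_0 \<Rightarrow> 'g::ab_group_add \<Rightarrow> 'g) \<Rightarrow> ('g \<Rightarrow> 'g \<Rightarrow> 'g) \<Rightarrow>
      ('g list \<Rightarrow>\<^sub>0 'k) set \<Rightarrow> ('g list \<Rightarrow>\<^sub>0 'k) set"
  where "PBW scale bracket = induced (\<lambda>p. lin_ext pscale symmetrize p +o env_ideal scale bracket)"

definition Hom ::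
    "('k::field \<Rightarrow> 'a::ab_group_add \<Rightarrow> 'a) \<Rightarrow> ('k \<Rightarrow> 'b::ab_group_add \<Rightarrow> 'b) \<Rightarrow> ('a \<Rightarrow> 'b) set"
  where "Hom scaleA scaleB = {f. Vector_Spaces.linear scaleA scaleB f}"

text \<open>The word \<open>x\<^sub>1 \<cdots> x\<^sub>n\<close> acts as \<open>rho x\<^sub>1 \<circ> \<cdots> \<circ> rho x\<^sub>n\<close>.\<close>

definition env_act ::
    "('k::field \<Rightarrow> 'v::ab_group_add \<Rightarrow> 'v) \<Rightarrow> ('g \<Rightarrow> 'v \<Rightarrow> 'v) \<Rightarrow> ('g list \<Rightarrow>\<^sub>0 'k) set \<Rightarrow> 'v \<Rightarrow> 'v"
  where "env_act scaleV rho = induced (\<lambda>p v. lin_ext scaleV (\<lambda>w. foldr rho w v) p)"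


section \<open>The dual space and tensor products\<close>

definition dual_space :: "('k::field \<Rightarrow> 'g::ab_group_add \<Rightarrow> 'g) \<Rightarrow> ('g \<Rightarrow> 'k) set"
  where "dual_space scale = Hom scale (*)"

definition dual_scale :: "'k::field \<Rightarrow> ('g \<Rightarrow> 'k) \<Rightarrow> 'g \<Rightarrow> 'k"
  where "dual_scale c \<xi> = (\<lambda>x. c * \<xi> x)"

text \<open>
  \<open>V \<otimes> B\<close> is the free vector space on \<open>V \<times> B\<close> modulo bilinearity. Here \<open>B\<close> is a carrier set with
  explicit operations, since it may itself be a set of cosets. \<open>v \<otimes> b\<close> is the coset of
  \<open>Poly_Mapping.single (v, b) 1\<close>.
\<close>

definition tensor_relations ::
    "('k::field \<Rightarrow> 'v::ab_group_add \<Rightarrow> 'v) \<Rightarrow> 'b set \<Rightarrow> ('b \<Rightarrow> 'b \<Rightarrow> 'b) \<Rightarrow> ('k \<Rightarrow> 'b \<Rightarrow> 'b) \<Rightarrow>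
      ('v \<times> 'b \<Rightarrow>\<^sub>0 'k) set"
  where "tensor_relations scaleV B addB scaleB = module.span pscale (
    {Poly_Mapping.single (u + v, b) 1 - Poly_Mapping.single (u, b) 1 - Poly_Mapping.single (v, b) 1
      | u v b. b \<in> B} \<union>
    {Poly_Mapping.single (scaleV c v, b) 1 - Poly_Mapping.single (v, b) c | c v b. b \<in> B} \<union>
    {Poly_Mapping.single (v, addB a b) 1 - Poly_Mapping.single (v, a) 1 - Poly_Mapping.single (v, b) 1
      | v a b. a \<in> B \<and> b \<in> B} \<union>
    {Poly_Mapping.single (v, scaleB c b) 1 - Poly_Mapping.single (v, b) c | c v b. b \<in> B})"

definition tensor_space ::
    "('k::field \<Rightarrow> 'v::ab_group_add \<Rightarrow> 'v) \<Rightarrow> 'b set \<Rightarrow> ('b \<Rightarrow> 'b \<Rightarrow> 'b) \<Rightarrow> ('k \<Rightarrow> 'b \<Rightarrow> 'b) \<Rightarrow>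
      ('v \<times> 'b \<Rightarrow>\<^sub>0 'k) set set"
  where "tensor_space scaleV B addB scaleB =
    (\<lambda>p. p +o tensor_relations scaleV B addB scaleB) ` free_on (UNIV \<times> B)"

text \<open>The ideal defining \<open>S(g\<^sup>*)\<close>, and the relations defining \<open>V \<otimes> g\<^sup>*\<close> and \<open>V \<otimes> S(g\<^sup>*)\<close>.\<close>

abbreviation Sdual_ideal ::
    "('k::field \<Rightarrow> 'g::ab_group_add \<Rightarrow> 'g) \<Rightarrow> (('g \<Rightarrow> 'k) list \<Rightarrow>\<^sub>0 'k) set"
  where "Sdual_ideal scaleG \<equiv> sym_ideal dual_scale (dual_space scaleG)"

abbreviation Sdual ::
    "('k::field \<Rightarrow> 'g::ab_group_add \<Rightarrow> 'g) \<Rightarrow> (('g \<Rightarrow> 'k) list \<Rightarrow>\<^sub>0 'k) set set"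
  where "Sdual scaleG \<equiv> sym_alg dual_scale (dual_space scaleG)"

abbreviation V_dual_rel ::
    "('k::field \<Rightarrow> 'g::ab_group_add \<Rightarrow> 'g) \<Rightarrow> ('k \<Rightarrow> 'v::ab_group_add \<Rightarrow> 'v) \<Rightarrow>
      ('v \<times> ('g \<Rightarrow> 'k) \<Rightarrow>\<^sub>0 'k) set"
  where "V_dual_rel scaleG scaleV \<equiv> tensor_relations scaleV (dual_space scaleG) (+) dual_scale"

abbreviation V_Sdual_rel ::
    "('k::field \<Rightarrow> 'g::ab_group_add \<Rightarrow> 'g) \<Rightarrow> ('k \<Rightarrow> 'v::ab_group_add \<Rightarrow> 'v) \<Rightarrow>
      ('v \<times> (('g \<Rightarrow> 'k) list \<Rightarrow>\<^sub>0 'k) set \<Rightarrow>\<^sub>0 'k) set"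
  where "V_Sdual_rel scaleG scaleV \<equiv>
    tensor_relations scaleV (Sdual scaleG) (+) (qscale (Sdual_ideal scaleG))"


section \<open>The map \<open>\<Lambda>\<close>, its exponential and the contraction\<close>

text \<open>
  \<open>\<Lambda> v \<in> V \<otimes> g\<^sup>*\<close> is the tensor that corresponds to \<open>x \<mapsto> rho x v\<close>, written out in a basis \<open>B\<close> of \<open>g\<close> and
  its dual basis; see \<open>evaluate_Lambda\<close> below.
\<close>

definition Lambda ::
    "('k::field \<Rightarrow> 'g::ab_group_add \<Rightarrow> 'g) \<Rightarrow> 'g set \<Rightarrow> ('k \<Rightarrow> 'v::ab_group_add \<Rightarrow> 'v) \<Rightarrow> ('g \<Rightarrow> 'v \<Rightarrow> 'v) \<Rightarrow>
      'v \<Rightarrow> ('v \<times> ('g \<Rightarrow> 'k) \<Rightarrow>\<^sub>0 'k) set"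
  where "Lambda scaleG B scaleV rho v =
    (\<Sum>b\<in>B. Poly_Mapping.single (rho b v, \<lambda>x. module.representation scaleG B x b) 1)
      +o V_dual_rel scaleG scaleV"

text \<open>The map \<open>V \<otimes> g\<^sup>* \<rightarrow> V \<otimes> S(g\<^sup>*)\<close> with \<open>u \<otimes> \<xi> \<mapsto> u \<otimes> \<xi>f\<close>.\<close>

definition tensor_mult ::
    "('k::field \<Rightarrow> 'g::ab_group_add \<Rightarrow> 'g) \<Rightarrow> ('k \<Rightarrow> 'v::ab_group_add \<Rightarrow> 'v) \<Rightarrow>
      (('g \<Rightarrow> 'k) list \<Rightarrow>\<^sub>0 'k) set \<Rightarrow> ('v \<times> ('g \<Rightarrow> 'k) \<Rightarrow>\<^sub>0 'k) set \<Rightarrow>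
      ('v \<times> (('g \<Rightarrow> 'k) list \<Rightarrow>\<^sub>0 'k) set \<Rightarrow>\<^sub>0 'k) set"
  where "tensor_mult scaleG scaleV f = induced (\<lambda>p.
    lin_ext pscale (\<lambda>(u, \<xi>). Poly_Mapping.single
        (u, quot_mult (Sdual_ideal scaleG) (letter \<xi> +o Sdual_ideal scaleG) f) 1) p
      +o V_Sdual_rel scaleG scaleV)"

text \<open>
  One iteration of \<open>\<Lambda>\<close>: \<open>V \<otimes> S\<^sup>k(g\<^sup>*) \<rightarrow> V \<otimes> g\<^sup>* \<otimes> S\<^sup>k(g\<^sup>*) \<rightarrow> V \<otimes> S\<^sup>k\<^sup>+\<^sup>1(g\<^sup>*)\<close>, where \<open>v \<otimes> f\<close> goes to \<open>\<Lambda> v\<close>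
  multiplied by \<open>f\<close>.
\<close>

definition Lambda_step ::
    "('k::field \<Rightarrow> 'g::ab_group_add \<Rightarrow> 'g) \<Rightarrow> 'g set \<Rightarrow> ('k \<Rightarrow> 'v::ab_group_add \<Rightarrow> 'v) \<Rightarrow> ('g \<Rightarrow> 'v \<Rightarrow> 'v) \<Rightarrow>
      ('v \<times> (('g \<Rightarrow> 'k) list \<Rightarrow>\<^sub>0 'k) set \<Rightarrow>\<^sub>0 'k) set \<Rightarrow>
      ('v \<times> (('g \<Rightarrow> 'k) list \<Rightarrow>\<^sub>0 'k) set \<Rightarrow>\<^sub>0 'k) set"
  where "Lambda_step scaleG B scaleV rho = induced (quot_lin_ext (V_Sdual_rel scaleG scaleV)
    (\<lambda>(v, f). tensor_mult scaleG scaleV f (Lambda scaleG B scaleV rho v)))"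

definition Lambda_power ::
    "('k::field \<Rightarrow> 'g::ab_group_add \<Rightarrow> 'g) \<Rightarrow> 'g set \<Rightarrow> ('k \<Rightarrow> 'v::ab_group_add \<Rightarrow> 'v) \<Rightarrow> ('g \<Rightarrow> 'v \<Rightarrow> 'v) \<Rightarrow>
      nat \<Rightarrow> 'v \<Rightarrow> ('v \<times> (('g \<Rightarrow> 'k) list \<Rightarrow>\<^sub>0 'k) set \<Rightarrow>\<^sub>0 'k) set"
  where "Lambda_power scaleG B scaleV rho k v = (Lambda_step scaleG B scaleV rho ^^ k)
    (Poly_Mapping.single (v, 1 +o Sdual_ideal scaleG) 1 +o V_Sdual_rel scaleG scaleV)"

text \<open>The degree \<open>k\<close> term of \<open>exp(\<Lambda>)\<close>.\<close>

definition exp_Lambda ::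
    "('k::field_char_0 \<Rightarrow> 'g::ab_group_add \<Rightarrow> 'g) \<Rightarrow> 'g set \<Rightarrow> ('k \<Rightarrow> 'v::ab_group_add \<Rightarrow> 'v) \<Rightarrow>
      ('g \<Rightarrow> 'v \<Rightarrow> 'v) \<Rightarrow> nat \<Rightarrow> 'v \<Rightarrow> ('v \<times> (('g \<Rightarrow> 'k) list \<Rightarrow>\<^sub>0 'k) set \<Rightarrow>\<^sub>0 'k) set"
  where "exp_Lambda scaleG B scaleV rho k v =
    qscale (V_Sdual_rel scaleG scaleV) (1 / fact k) (Lambda_power scaleG B scaleV rho k v)"

text \<open>
  The pairing of \<open>S(g\<^sup>*)\<close> and \<open>S(g)\<close>: the given one in each degree, extended by zero to pairs of
  elements of different degrees.
\<close>

definition word_pairing :: "('g \<Rightarrow> 'k::field) list \<Rightarrow> 'g list \<Rightarrow> 'k"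
  where "word_pairing \<xi>s xs = (if length \<xi>s = length xs
    then \<Sum>\<sigma> | \<sigma> permutes {..<length xs}. \<Prod>i<length xs. (\<xi>s ! i) (xs ! \<sigma> i) else 0)"

definition pairing :: "(('g \<Rightarrow> 'k::field) list \<Rightarrow>\<^sub>0 'k) set \<Rightarrow> ('g list \<Rightarrow>\<^sub>0 'k) set \<Rightarrow> 'k"
  where "pairing = induced2 (\<lambda>p q. lin_ext (*) (\<lambda>\<xi>s. lin_ext (*) (word_pairing \<xi>s) q) p)"

text \<open>Contraction of \<open>s \<in> S(g)\<close> with an element of \<open>V \<otimes> S(g\<^sup>*)\<close>.\<close>

definition contract ::
    "('k::field \<Rightarrow> 'v::ab_group_add \<Rightarrow> 'v) \<Rightarrow> ('g list \<Rightarrow>\<^sub>0 'k) set \<Rightarrow>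
      ('v \<times> (('g \<Rightarrow> 'k) list \<Rightarrow>\<^sub>0 'k) set \<Rightarrow>\<^sub>0 'k) set \<Rightarrow> 'v"
  where "contract scaleV s = induced (lin_ext scaleV (\<lambda>(v, f). scaleV (pairing f s) v))"

text \<open>
  The endomorphism obtained by contracting \<open>s\<close> with \<open>exp(\<Lambda>)\<close>. Only the degree \<open>k\<close> part of \<open>s\<close> contributes
  to the \<open>k\<close>-th summand, so the sum is finite.
\<close>

definition contract_exp_Lambda ::
    "('k::field_char_0 \<Rightarrow> 'g::ab_group_add \<Rightarrow> 'g) \<Rightarrow> 'g set \<Rightarrow> ('k \<Rightarrow> 'v::ab_group_add \<Rightarrow> 'v) \<Rightarrow>
      ('g \<Rightarrow> 'v \<Rightarrow> 'v) \<Rightarrow> ('g list \<Rightarrow>\<^sub>0 'k) set \<Rightarrow> 'v \<Rightarrow> 'v"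
  where "contract_exp_Lambda scaleG B scaleV rho s v =
    Sum_any (\<lambda>k. contract scaleV s (exp_Lambda scaleG B scaleV rho k v))"

section \<open>The induced maps are well defined\<close>

subsection \<open>Linear maps on free vector spaces and cosets\<close>

lemma lookup_pscale [simp]: "Poly_Mapping.lookup (pscale c p) a = c * Poly_Mapping.lookup p a"
  by (simp add: pscale_def Poly_Mapping.map.rep_eq when_def)

interpretation pm: vector_space "pscale :: 'k::field \<Rightarrow> ('a \<Rightarrow>\<^sub>0 'k) \<Rightarrow> ('a \<Rightarrow>\<^sub>0 'k)"
  by unfold_locales (auto intro!: poly_mapping_eqI simp: lookup_add algebra_simps)

lemma pscale_single [simp]: "pscale c (Poly_Mapping.single a d) = Poly_Mapping.single a (c * d)"
  by (rule poly_mapping_eqI) (simp add: lookup_single when_def)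

lemma lin_ext_superset:
  assumes "vector_space scale" "finite A" "Poly_Mapping.keys p \<subseteq> A"
  shows "lin_ext scale f p = (\<Sum>a\<in>A. scale (Poly_Mapping.lookup p a) (f a))"
proof -
  interpret vector_space scale by fact
  show ?thesis
    unfolding lin_ext_def using assms(2,3)
    by (intro sum.mono_neutral_left) (auto simp: in_keys_iff)
qed

lemma linear_lin_ext:
  fixes scale :: "'a::field \<Rightarrow> 'c::ab_group_add \<Rightarrow> 'c" and f :: "'b \<Rightarrow> 'c"
  assumes "vector_space scale"
  shows "Vector_Spaces.linear pscale scale (lin_ext scale f)"
proof -
  interpret S: vector_space scale by fact
  show ?thesis
    unfolding Vector_Spaces.linear_iff
  proof (intro conjI allI)
    fix p q :: "'b \<Rightarrow>\<^sub>0 'a"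
    let ?A = "Poly_Mapping.keys p \<union> Poly_Mapping.keys q"
    show "lin_ext scale f (p + q) = lin_ext scale f p + lin_ext scale f q"
      using keys_add[of p q]
      by (simp add: lin_ext_superset[OF assms, of ?A] lookup_add S.scale_left_distrib sum.distrib)
  next
    fix c and p :: "'b \<Rightarrow>\<^sub>0 'a"
    have "Poly_Mapping.keys (pscale c p) \<subseteq> Poly_Mapping.keys p" by (auto simp: in_keys_iff)
    then show "lin_ext scale f (pscale c p) = scale c (lin_ext scale f p)"
      by (simp add: lin_ext_superset[OF assms, of "Poly_Mapping.keys p"] S.scale_sum_right)
  qed (fact assms pm.vector_space_axioms)+
qed

lemma lin_ext_single:
  "vector_space scale \<Longrightarrow> lin_ext scale f (Poly_Mapping.single a c) = scale c (f a)"
  by (simp add: lin_ext_superset[of _ "{a}"])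

lemma poly_mapping_sum_single:
  "p = (\<Sum>a\<in>Poly_Mapping.keys p. Poly_Mapping.single a (Poly_Mapping.lookup p a))"
  by (rule poly_mapping_eqI)
    (auto simp: lookup_sum lookup_single when_def in_keys_iff sum.delta' cong: sum.cong)

lemma coset_eq_iff:
  assumes "pm.subspace N"
  shows "p +o N = q +o N \<longleftrightarrow> p - q \<in> N"
proof
  assume "p +o N = q +o N"
  moreover have "p \<in> p +o N"
    using pm.subspace_0[OF assms] by (auto simp: elt_set_plus_def)
  ultimately show "p - q \<in> N" by (simp add: set_minus_plus)
next
  assume *: "p - q \<in> N"
  show "p +o N = q +o N"
  proof (intro equalityI subsetI)
    fix x assume "x \<in> p +o N"
    then have "(x - p) + (p - q) \<in> N"
      using * pm.subspace_add[OF assms] by (simp only: set_minus_plus[symmetric])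
    then show "x \<in> q +o N" by (simp add: set_minus_plus[symmetric])
  next
    fix x assume "x \<in> q +o N"
    then have "(x - q) - (p - q) \<in> N"
      using * pm.subspace_diff[OF assms] by (simp only: set_minus_plus[symmetric])
    then show "x \<in> p +o N" by (simp add: set_minus_plus[symmetric])
  qed
qed

lemma subspace_plus_self:
  assumes "pm.subspace N" shows "N + N = N"
  using pm.subspace_0[OF assms] pm.subspace_add[OF assms]
  by (force simp: set_plus_def)

lemma coset_add:
  "pm.subspace N \<Longrightarrow> (p +o N) + (q +o N) = (p + q) +o N"
  by (simp add: set_plus_rearrange subspace_plus_self)

lemma induced_coset:
  fixes p :: "'a::ab_group_add"
  assumes "0 \<in> N" "\<And>n. n \<in> N \<Longrightarrow> f (p + n) = f p"
  shows "induced f (p +o N) = f p"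
proof -
  have "p + 0 \<in> p +o N" using assms(1) by (rule set_plus_intro2)
  then have "f p \<in> f ` (p +o N)" by simp
  moreover have "f ` (p +o N) \<subseteq> {f p}" using assms(2) by (auto simp: elt_set_plus_def)
  ultimately have "f ` (p +o N) = {f p}" by blast
  then show ?thesis by (simp add: induced_def)
qed

lemma induced2_coset:
  fixes p :: "'a::ab_group_add" and q :: "'b::ab_group_add"
  assumes "0 \<in> N" "0 \<in> M" "\<And>n m. n \<in> N \<Longrightarrow> m \<in> M \<Longrightarrow> f (p + n) (q + m) = f p q"
  shows "induced2 f (p +o N) (q +o M) = f p q"
proof -
  let ?f = "\<lambda>(x, y). f x y"
  have "(p + 0, q + 0) \<in> (p +o N) \<times> (q +o M)" using assms(1,2) by blast
  then have "?f (p + 0, q + 0) \<in> ?f ` ((p +o N) \<times> (q +o M))" by (rule imageI)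
  moreover have "?f ` ((p +o N) \<times> (q +o M)) \<subseteq> {f p q}" using assms(3) by (auto simp: elt_set_plus_def)
  ultimately have "?f ` ((p +o N) \<times> (q +o M)) = {f p q}" by auto
  then show ?thesis by (simp add: induced2_def)
qed

lemma linear_vanishes_on_span:
  assumes "Vector_Spaces.linear pscale scale F" "\<And>r. r \<in> R \<Longrightarrow> F r = 0" "n \<in> pm.span R"
  shows "F n = 0"
proof -
  interpret Vector_Spaces.linear pscale scale F by fact
  from assms(3) show ?thesis
    by (induction rule: pm.span_induct_alt) (auto simp: assms(2) zero add scale)
qed

lemma linear_maps_span:
  assumes "Vector_Spaces.linear pscale scale F" "module.subspace scale M"
    "\<And>r. r \<in> R \<Longrightarrow> F r \<in> M" "n \<in> pm.span R"
  shows "F n \<in> M"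
proof -
  interpret Vector_Spaces.linear pscale scale F by fact
  from assms(4) show ?thesis
    by (induction rule: pm.span_induct_alt)
      (auto simp: zero add scale intro!: vs2.subspace_0[OF assms(2)] vs2.subspace_add[OF assms(2)]
        vs2.subspace_scale[OF assms(2)] assms(3))
qed

lemma induced_linear:
  assumes "Vector_Spaces.linear pscale scale F" "\<And>r. r \<in> R \<Longrightarrow> F r = 0"
  shows "induced F (p +o pm.span R) = F p"
proof -
  interpret Vector_Spaces.linear pscale scale F by fact
  show ?thesis
    by (rule induced_coset)
      (auto simp: pm.span_zero add linear_vanishes_on_span[OF assms(1,2)])
qed

lemma induced_linear_coset:
  assumes "Vector_Spaces.linear pscale pscale F" "pm.subspace M" "\<And>r. r \<in> R \<Longrightarrow> F r \<in> M"
  shows "induced (\<lambda>p. F p +o M) (p +o pm.span R) = F p +o M"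
proof -
  interpret Vector_Spaces.linear pscale pscale F by fact
  show ?thesis
    by (rule induced_coset)
      (auto simp: pm.span_zero coset_eq_iff[OF assms(2)] add linear_maps_span[OF assms(1,2,3)])
qed

lemma qscale_coset:
  assumes "pm.subspace N"
  shows "qscale N c (p +o N) = pscale c p +o N"
  unfolding qscale_def
  by (rule induced_coset)
    (auto simp: coset_eq_iff[OF assms] pm.scale_right_distrib pm.subspace_0[OF assms] pm.subspace_scale[OF assms])

lemma quot_lin_ext_coset:
  assumes "pm.subspace N" "\<And>a. a \<in> Poly_Mapping.keys p \<Longrightarrow> F a = h a +o N"
  shows "quot_lin_ext N F p = lin_ext pscale h p +o N"
proof -
  have *: "N + (\<Sum>a\<in>A. qscale N (Poly_Mapping.lookup p a) (F a)) =
      (\<Sum>a\<in>A. pscale (Poly_Mapping.lookup p a) (h a)) +o N"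
    if "A \<subseteq> Poly_Mapping.keys p" "finite A" for A
    using that(2,1)
  proof (induction A)
    case (insert a A)
    have "N + (\<Sum>a\<in>insert a A. qscale N (Poly_Mapping.lookup p a) (F a)) =
        qscale N (Poly_Mapping.lookup p a) (F a) + (N + (\<Sum>a\<in>A. qscale N (Poly_Mapping.lookup p a) (F a)))"
      using insert by (simp only: sum.insert not_False_eq_True add.left_commute)
    also have "\<dots> = (pscale (Poly_Mapping.lookup p a) (h a) +o N) + ((\<Sum>a\<in>A. pscale (Poly_Mapping.lookup p a) (h a)) +o N)"
      using insert assms(2)[of a] by (simp add: qscale_coset[OF assms(1)])
    finally show ?case using insert by (simp add: coset_add[OF assms(1)])
  qed simp
  show ?thesis unfolding quot_lin_ext_def lin_ext_def by (rule *) auto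
qed

subsection \<open>Ideals of the free algebra\<close>

lemma single_mult_single [simp]:
  "Poly_Mapping.single u a * Poly_Mapping.single v b = Poly_Mapping.single (u @ v) (a * b)"
  by (simp add: mult_single plus_list_def)

lemma one_poly_mapping_list: "1 = Poly_Mapping.single [] 1"
  by (metis single_one zero_list_def)

lemma pscale_mult_left: "pscale c (p * q) = pscale c p * (q :: 'a list \<Rightarrow>\<^sub>0 'k::field)"
  by (simp add: pscale_def mult_map_scale_conv_mult mult.assoc)

lemma pscale_mult_right: "pscale c (p * q) = p * pscale c (q :: 'a list \<Rightarrow>\<^sub>0 'k::field)"
proof -
  have "Poly_Mapping.single 0 c * p = p * Poly_Mapping.single 0 c"
    by (subst (1 2) poly_mapping_sum_single[of p])
      (simp add: sum_distrib_left sum_distrib_right zero_list_def mult.commute)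
  then show ?thesis
    by (simp add: pscale_def mult_map_scale_conv_mult flip: mult.assoc)
qed

lemma linear_times_left: "Vector_Spaces.linear pscale pscale (\<lambda>p :: 'a list \<Rightarrow>\<^sub>0 'k::field. q * p)"
  by (auto simp: Vector_Spaces.linear_iff distrib_left pscale_mult_right pm.vector_space_axioms)

lemma linear_times_right: "Vector_Spaces.linear pscale pscale (\<lambda>p :: 'a list \<Rightarrow>\<^sub>0 'k::field. p * q)"
  by (auto simp: Vector_Spaces.linear_iff distrib_right pscale_mult_left pm.vector_space_axioms)

lemma subspace_ideal: "pm.subspace (two_sided_ideal W R)"
  by (simp add: two_sided_ideal_def pm.subspace_span)

lemma ideal_generator:
  "u \<in> lists W \<Longrightarrow> r \<in> R \<Longrightarrow> v \<in> lists W \<Longrightarrow>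
    Poly_Mapping.single u 1 * r * Poly_Mapping.single v 1 \<in> two_sided_ideal W R"
  unfolding two_sided_ideal_def by (rule pm.span_base) blast

lemma linear_maps_ideal:
  assumes "Vector_Spaces.linear pscale scale F" "module.subspace scale M"
    "\<And>u r v. u \<in> lists W \<Longrightarrow> r \<in> R \<Longrightarrow> v \<in> lists W \<Longrightarrow>
      F (Poly_Mapping.single u 1 * r * Poly_Mapping.single v 1) \<in> M"
    "n \<in> two_sided_ideal W R"
  shows "F n \<in> M"
  by (rule linear_maps_span[OF assms(1,2) _ assms(4)[unfolded two_sided_ideal_def]]) (auto intro: assms(3))

lemma ideal_mult_word:
  assumes "n \<in> two_sided_ideal W R" "w \<in> lists W"
  shows "Poly_Mapping.single w 1 * n \<in> two_sided_ideal W R"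
    and "n * Poly_Mapping.single w 1 \<in> two_sided_ideal W R"
proof -
  show "Poly_Mapping.single w 1 * n \<in> two_sided_ideal W R"
  proof (rule linear_maps_ideal[OF linear_times_left subspace_ideal _ assms(1)])
    fix u r v assume "u \<in> lists W" "r \<in> R" "v \<in> lists W"
    then have "Poly_Mapping.single (w @ u) 1 * r * Poly_Mapping.single v 1 \<in> two_sided_ideal W R"
      using assms(2) by (intro ideal_generator) auto
    then show "Poly_Mapping.single w 1 * (Poly_Mapping.single u 1 * r * Poly_Mapping.single v 1) \<in> two_sided_ideal W R"
      by (simp flip: mult.assoc)
  qed
  show "n * Poly_Mapping.single w 1 \<in> two_sided_ideal W R"
  proof (rule linear_maps_ideal[OF linear_times_right subspace_ideal _ assms(1)])
    fix u r v assume "u \<in> lists W" "r \<in> R" "v \<in> lists W"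
    then have "Poly_Mapping.single u 1 * r * Poly_Mapping.single (v @ w) 1 \<in> two_sided_ideal W R"
      using assms(2) by (intro ideal_generator) auto
    then show "Poly_Mapping.single u 1 * r * Poly_Mapping.single v 1 * Poly_Mapping.single w 1 \<in> two_sided_ideal W R"
      by (simp add: mult.assoc)
  qed
qed

lemma free_on_induct [consumes 1, case_names single add]:
  fixes p :: "'a \<Rightarrow>\<^sub>0 'k::field"
  assumes "p \<in> free_on A" "\<And>a c. a \<in> A \<Longrightarrow> P (Poly_Mapping.single a c)"
    "\<And>p q. P p \<Longrightarrow> P q \<Longrightarrow> P (p + q)" "P 0"
  shows "P p"
proof -
  have "P (\<Sum>a\<in>B. Poly_Mapping.single a (Poly_Mapping.lookup p a))" if "B \<subseteq> A" "finite B" for B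
    using that(2,1) by (induction B) (auto intro: assms)
  then have "P (\<Sum>a\<in>Poly_Mapping.keys p. Poly_Mapping.single a (Poly_Mapping.lookup p a))"
    using assms(1) by (simp add: free_on_def)
  then show ?thesis by (simp flip: poly_mapping_sum_single)
qed

lemma subspace_free_on: "pm.subspace (free_on A :: ('a \<Rightarrow>\<^sub>0 'b::field) set)"
  unfolding pm.subspace_def
proof (intro conjI ballI allI)
  fix p q :: "'a \<Rightarrow>\<^sub>0 'b" and c assume p: "p \<in> free_on A"
  show "pscale c p \<in> free_on A" using p by (auto simp: free_on_def in_keys_iff)
  assume "q \<in> free_on A"
  with p show "p + q \<in> free_on A" using keys_add[of p q] by (auto simp: free_on_def)
qed (simp add: free_on_def)

lemma single_in_free_on: "a \<in> A \<Longrightarrow> Poly_Mapping.single a c \<in> free_on A"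
  by (simp add: free_on_def)

lemma free_on_mult:
  assumes "p \<in> free_on (lists W)" "q \<in> free_on (lists W)"
  shows "p * q \<in> free_on (lists W)"
proof -
  have "w \<in> lists W" if w: "w \<in> Poly_Mapping.keys (p * q)" for w
  proof -
    obtain u v where "u \<in> Poly_Mapping.keys p" "v \<in> Poly_Mapping.keys q" "w = u @ v"
      using subsetD[OF keys_mult w] by (auto simp: plus_list_def)
    with assms show ?thesis by (auto simp: free_on_def)
  qed
  then show ?thesis by (auto simp: free_on_def)
qed

lemma ideal_mult:
  assumes "n \<in> two_sided_ideal W R" "p \<in> free_on (lists W)"
  shows "p * n \<in> two_sided_ideal W R" "n * p \<in> two_sided_ideal W R"
proof -
  note S = pm.subspace_add[OF subspace_ideal] pm.subspace_scale[OF subspace_ideal]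
    pm.subspace_0[OF subspace_ideal]
  have "Poly_Mapping.single w c * n \<in> two_sided_ideal W R \<and>
      n * Poly_Mapping.single w c \<in> two_sided_ideal W R" if "w \<in> lists W" for w c
  proof -
    have "pscale c (Poly_Mapping.single w 1 * n) \<in> two_sided_ideal W R"
      "pscale c (n * Poly_Mapping.single w 1) \<in> two_sided_ideal W R"
      by (intro S ideal_mult_word assms(1) that)+
    then show ?thesis by (simp only: pscale_mult_left[of c "Poly_Mapping.single w 1"] pscale_mult_right[of c n] pscale_single mult_1_right)
  qed
  note 1 = this
  from assms(2) have "p * n \<in> two_sided_ideal W R \<and> n * p \<in> two_sided_ideal W R"
    by (induction rule: free_on_induct) (simp_all add: distrib_right distrib_left 1 S)
  then show "p * n \<in> two_sided_ideal W R" "n * p \<in> two_sided_ideal W R" by auto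
qed

lemma lin_map_diff:
  assumes "Vector_Spaces.linear s1 s2 F" shows "F (p - q) = F p - F q"
proof -
  interpret Vector_Spaces.linear s1 s2 F by fact
  show ?thesis by (rule diff)
qed

lemma lin_map_scale: "Vector_Spaces.linear s1 s2 F \<Longrightarrow> F (s1 c p) = s2 c (F p)"
  by (simp add: Vector_Spaces.linear_iff)

lemma lin_map_add: "Vector_Spaces.linear s1 s2 F \<Longrightarrow> F (p + q) = F p + F q"
  by (simp add: Vector_Spaces.linear_iff)

text \<open>Maps on words that are linear in each letter, and symmetric, descend to the symmetric algebra.\<close>

lemma sym_ideal_mapped:
  fixes F :: "('w::ab_group_add list \<Rightarrow>\<^sub>0 'k::field) \<Rightarrow> 'b::ab_group_add"
  assumes F: "Vector_Spaces.linear pscale scale F" and M: "module.subspace scale M"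
    and add: "\<And>u v x y. u \<in> lists W \<Longrightarrow> v \<in> lists W \<Longrightarrow> x \<in> W \<Longrightarrow> y \<in> W \<Longrightarrow>
      F (Poly_Mapping.single (u @ [x + y] @ v) 1) - F (Poly_Mapping.single (u @ [x] @ v) 1)
        - F (Poly_Mapping.single (u @ [y] @ v) 1) \<in> M"
    and scl: "\<And>u v c x. u \<in> lists W \<Longrightarrow> v \<in> lists W \<Longrightarrow> x \<in> W \<Longrightarrow>
      F (Poly_Mapping.single (u @ [scaleW c x] @ v) 1)
        - scale c (F (Poly_Mapping.single (u @ [x] @ v) 1)) \<in> M"
    and com: "\<And>u v x y. u \<in> lists W \<Longrightarrow> v \<in> lists W \<Longrightarrow> x \<in> W \<Longrightarrow> y \<in> W \<Longrightarrow>
      F (Poly_Mapping.single (u @ [x, y] @ v) 1) - F (Poly_Mapping.single (u @ [y, x] @ v) 1) \<in> M"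
    and n: "n \<in> sym_ideal scaleW W"
  shows "F n \<in> M"
proof (rule linear_maps_ideal[OF F M _ n[unfolded sym_ideal_def]], unfold linear_relators_def, elim UnE)
  fix u v :: "'w list" and r :: "'w list \<Rightarrow>\<^sub>0 'k"
  assume u: "u \<in> lists W" "v \<in> lists W"
  { assume "r \<in> {letter (x + y) - letter x - letter y |x y. x \<in> W \<and> y \<in> W}"
    then show "F (Poly_Mapping.single u 1 * r * Poly_Mapping.single v 1) \<in> M"
      using add[OF u] by (auto simp: letter_def left_diff_distrib right_diff_distrib lin_map_diff[OF F]) }
  { assume "r \<in> {letter (scaleW c x) - pscale c (letter x) |c x. x \<in> W}"
    then obtain c x where r: "r = letter (scaleW c x) - pscale c (letter x)" "x \<in> W" by blast
    have "Poly_Mapping.single u 1 * r * Poly_Mapping.single v 1 =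
        Poly_Mapping.single (u @ [scaleW c x] @ v) 1 - pscale c (Poly_Mapping.single (u @ [x] @ v) 1)"
      by (simp add: r(1) letter_def left_diff_distrib right_diff_distrib)
    then show "F (Poly_Mapping.single u 1 * r * Poly_Mapping.single v 1) \<in> M"
      using scl[OF u r(2)] by (simp only: lin_map_diff[OF F] lin_map_scale[OF F]) }
  { assume "r \<in> {letter x * letter y - letter y * letter x |x y. x \<in> W \<and> y \<in> W}"
    then show "F (Poly_Mapping.single u 1 * r * Poly_Mapping.single v 1) \<in> M"
      using com[OF u] by (auto simp: letter_def left_diff_distrib right_diff_distrib lin_map_diff[OF F]) }
qed

lemma env_ideal_mapped:
  fixes F :: "('w::ab_group_add list \<Rightarrow>\<^sub>0 'k::field) \<Rightarrow> 'b::ab_group_add"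
  assumes F: "Vector_Spaces.linear pscale scale F" and M: "module.subspace scale M"
    and add: "\<And>u v x y. F (Poly_Mapping.single (u @ [x + y] @ v) 1) - F (Poly_Mapping.single (u @ [x] @ v) 1)
        - F (Poly_Mapping.single (u @ [y] @ v) 1) \<in> M"
    and scl: "\<And>u v c x. F (Poly_Mapping.single (u @ [scaleG c x] @ v) 1)
        - scale c (F (Poly_Mapping.single (u @ [x] @ v) 1)) \<in> M"
    and com: "\<And>u v x y. F (Poly_Mapping.single (u @ [x, y] @ v) 1) - F (Poly_Mapping.single (u @ [y, x] @ v) 1)
        - F (Poly_Mapping.single (u @ [bracket x y] @ v) 1) \<in> M"
    and n: "n \<in> env_ideal scaleG bracket"
  shows "F n \<in> M"
proof (rule linear_maps_ideal[OF F M _ n[unfolded env_ideal_def]], unfold linear_relators_def, elim UnE)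
  fix u v :: "'w list" and r :: "'w list \<Rightarrow>\<^sub>0 'k"
  { assume "r \<in> {letter (x + y) - letter x - letter y |x y. x \<in> UNIV \<and> y \<in> UNIV}"
    then show "F (Poly_Mapping.single u 1 * r * Poly_Mapping.single v 1) \<in> M"
      using add by (auto simp: letter_def left_diff_distrib right_diff_distrib lin_map_diff[OF F]) }
  { assume "r \<in> {letter (scaleG c x) - pscale c (letter x) |c x. x \<in> UNIV}"
    then obtain c x where r: "r = letter (scaleG c x) - pscale c (letter x)" "x \<in> UNIV" by blast
    have "Poly_Mapping.single u 1 * r * Poly_Mapping.single v 1 =
        Poly_Mapping.single (u @ [scaleG c x] @ v) 1 - pscale c (Poly_Mapping.single (u @ [x] @ v) 1)"
      by (simp add: r(1) letter_def left_diff_distrib right_diff_distrib)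
    then show "F (Poly_Mapping.single u 1 * r * Poly_Mapping.single v 1) \<in> M"
      using scl by (simp only: lin_map_diff[OF F] lin_map_scale[OF F]) }
  { assume "r \<in> {letter x * letter y - letter y * letter x - letter (bracket x y) |x y. True}"
    then show "F (Poly_Mapping.single u 1 * r * Poly_Mapping.single v 1) \<in> M"
      using com by (auto simp: letter_def left_diff_distrib right_diff_distrib lin_map_diff[OF F]) }
qed

lemma subspace_sym_ideal: "pm.subspace (sym_ideal scale W)"
  by (simp add: sym_ideal_def subspace_ideal)

lemma subspace_env_ideal: "pm.subspace (env_ideal scale bracket)"
  by (simp add: env_ideal_def subspace_ideal)

lemma ideal_subset_free_on:
  assumes "R \<subseteq> free_on (lists W)"
  shows "two_sided_ideal W R \<subseteq> free_on (lists W)"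
proof -
  have "Poly_Mapping.single u 1 * r * Poly_Mapping.single v 1 \<in> free_on (lists W)"
    if "u \<in> lists W" "r \<in> R" "v \<in> lists W" for u r v
    using assms that by (intro free_on_mult single_in_free_on) auto
  then show ?thesis
    unfolding two_sided_ideal_def by (intro pm.span_minimal subspace_free_on) blast
qed

lemma sym_ideal_subset_free_on:
  assumes "\<And>x y. x \<in> W \<Longrightarrow> y \<in> W \<Longrightarrow> x + y \<in> W" "\<And>c x. x \<in> W \<Longrightarrow> scale c x \<in> W"
  shows "sym_ideal scale W \<subseteq> free_on (lists W)"
  unfolding sym_ideal_def
proof (rule ideal_subset_free_on)
  have letter: "letter x \<in> free_on (lists W)" if "x \<in> W" for x
    using that by (simp add: letter_def free_on_def)
  note diff = pm.subspace_diff[OF subspace_free_on]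
  have "letter (x + y) - letter x - letter y \<in> free_on (lists W)"
    "letter x * letter y - letter y * letter x \<in> free_on (lists W)" if "x \<in> W" "y \<in> W" for x y
    by (intro diff free_on_mult letter assms that)+
  moreover have "letter (scale c x) - pscale c (letter x) \<in> free_on (lists W)" if "x \<in> W" for c x
    by (intro diff pm.subspace_scale[OF subspace_free_on] letter assms that)
  ultimately show "linear_relators scale W \<union>
      {letter x * letter y - letter y * letter x | x y. x \<in> W \<and> y \<in> W} \<subseteq> free_on (lists W)"
    unfolding linear_relators_def by blast
qed

lemma quot_mult_coset:
  assumes "p \<in> free_on (lists W)" "q \<in> free_on (lists W)" "two_sided_ideal W R \<subseteq> free_on (lists W)"
  shows "quot_mult (two_sided_ideal W R) (p +o two_sided_ideal W R) (q +o two_sided_ideal W R)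
    = (p * q) +o two_sided_ideal W R"
  unfolding quot_mult_def
proof (rule induced2_coset)
  let ?I = "two_sided_ideal W R"
  fix n m assume n: "n \<in> ?I" and m: "m \<in> ?I"
  have "m \<in> free_on (lists W)" using m assms(3) by blast
  then have "p * m + n * q + n * m \<in> ?I"
    using n m assms(1,2) by (intro pm.subspace_add[OF subspace_ideal] ideal_mult(1)[OF m] ideal_mult(2)[OF n])
  moreover have "(p + n) * (q + m) - p * q = p * m + n * q + n * m"
    by (simp add: algebra_simps)
  ultimately show "(p + n) * (q + m) +o ?I = (p * q) +o ?I"
    by (simp add: coset_eq_iff[OF subspace_ideal])
qed (simp_all add: pm.subspace_0[OF subspace_ideal])

subsection \<open>The maps \<open>PBW\<close>, the adjoint actions and the action on \<open>V\<close>\<close>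

lemma induced_coset_linear:
  assumes "Vector_Spaces.linear pscale pscale F" "pm.subspace N" "pm.subspace M"
    "\<And>n. n \<in> N \<Longrightarrow> F n \<in> M"
  shows "induced (\<lambda>p. F p +o M) (p +o N) = F p +o M"
  by (rule induced_coset)
    (auto simp: pm.subspace_0[OF assms(2)] coset_eq_iff[OF assms(3)] lin_map_add[OF assms(1)] assms(4))

lemma linear_lin_ext_pscale: "Vector_Spaces.linear pscale pscale (lin_ext pscale f)"
  by (rule linear_lin_ext) (rule pm.vector_space_axioms)

lemma lin_ext_pscale_single [simp]: "lin_ext pscale f (Poly_Mapping.single a c) = pscale c (f a)"
  by (rule lin_ext_single) (rule pm.vector_space_axioms)

lemma permute_list_slot:
  assumes "\<sigma> permutes {..<Suc (length u + length v)}"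
  obtains a b where "\<And>z. permute_list \<sigma> (u @ [z] @ v) = a @ [z] @ b"
proof -
  let ?n = "Suc (length u + length v)"
  define j where "j = inv \<sigma> (length u)"
  have sj: "\<sigma> j = length u" using permutes_inverses(1)[OF assms] by (simp add: j_def)
  have j: "j < ?n"
    using permutes_in_image[OF permutes_inv[OF assms], of "length u"] by (simp add: j_def)
  let ?p = "permute_list \<sigma> (u @ [undefined] @ v)"
  have "permute_list \<sigma> (u @ [z] @ v) = ?p[j := z]" for z
  proof (rule nth_equalityI)
    fix i assume "i < length (permute_list \<sigma> (u @ [z] @ v))"
    then have i: "i < ?n" by simp
    have nth: "permute_list \<sigma> (u @ [y] @ v) ! i = (u @ [y] @ v) ! \<sigma> i" for y
      using i assms by (intro permute_list_nth) auto
    show "permute_list \<sigma> (u @ [z] @ v) ! i = ?p[j := z] ! i"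
    proof (cases "i = j")
      case True
      then show ?thesis using i sj unfolding nth by (simp add: nth_append)
    next
      case False
      then have "\<sigma> i \<noteq> length u" using sj permutes_inj[OF assms] by (metis injD)
      then have "(u @ [z] @ v) ! \<sigma> i = (u @ [undefined] @ v) ! \<sigma> i"
        by (auto simp: nth_append nth_Cons split: nat.splits)
      then show ?thesis using False unfolding nth by (metis nth nth_list_update_neq)
    qed
  qed simp
  also have "?p[j := z] = take j ?p @ [z] @ drop (Suc j) ?p" for z
    using j by (simp add: upd_conv_take_nth_drop)
  finally show thesis by (rule that)
qed

lemma symmetrize_permute:
  assumes "\<tau> permutes {..<length w}"
  shows "symmetrize (permute_list \<tau> w) = symmetrize w"
proof -
  let ?P = "{\<sigma>. \<sigma> permutes {..<length w}}"
  have "(\<Sum>\<sigma>\<in>?P. Poly_Mapping.single (permute_list \<sigma> (permute_list \<tau> w)) (1::'b))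
      = (\<Sum>\<sigma>\<in>?P. Poly_Mapping.single (permute_list (\<tau> \<circ> \<sigma>) w) 1)"
    by (intro sum.cong refl) (simp add: permute_list_compose)
  also have "\<dots> = (\<Sum>\<sigma>\<in>?P. Poly_Mapping.single (permute_list \<sigma> w) 1)"
    by (rule setum_permutations_compose_left[OF assms, symmetric])
  finally show ?thesis by (simp add: symmetrize_def)
qed
lemma in_two_sided_ideal:
  assumes "r \<in> R" shows "r \<in> two_sided_ideal W R"
proof -
  have "Poly_Mapping.single [] 1 * r * Poly_Mapping.single [] 1 = r"
    by (simp flip: one_poly_mapping_list)
  with ideal_generator[of "[]" W r R "[]"] assms show ?thesis by simp
qed

lemma ideal_mult_UNIV:
  assumes "n \<in> two_sided_ideal UNIV R"
  shows "p * n \<in> two_sided_ideal UNIV R" "n * p \<in> two_sided_ideal UNIV R"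
  using ideal_mult[OF assms, of p] by (simp_all add: free_on_def)

lemma env_ideal_relations:
  "Poly_Mapping.single (u @ [x + y] @ v) 1 - Poly_Mapping.single (u @ [x] @ v) 1
      - Poly_Mapping.single (u @ [y] @ v) 1 \<in> env_ideal scaleG bracket"
  "Poly_Mapping.single (u @ [scaleG c x] @ v) 1 - Poly_Mapping.single (u @ [x] @ v) c
      \<in> env_ideal scaleG bracket"
proof -
  let ?R = "linear_relators scaleG UNIV \<union>
    {letter x * letter y - letter y * letter x - letter (bracket x y) | x y. True}"
  have "letter (x + y) - letter x - letter y \<in> ?R"
    "letter (scaleG c x) - pscale c (letter x) \<in> ?R"
    unfolding linear_relators_def by blast+
  from this[THEN ideal_generator[of u UNIV _ _ v, simplified]]
  show "Poly_Mapping.single (u @ [x + y] @ v) 1 - Poly_Mapping.single (u @ [x] @ v) 1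
      - Poly_Mapping.single (u @ [y] @ v) 1 \<in> env_ideal scaleG bracket"
    "Poly_Mapping.single (u @ [scaleG c x] @ v) 1 - Poly_Mapping.single (u @ [x] @ v) c
      \<in> env_ideal scaleG bracket"
    by (simp_all add: env_ideal_def letter_def left_diff_distrib right_diff_distrib)
qed

lemma symmetrize_sym_ideal:
  fixes scaleG :: "'k::field_char_0 \<Rightarrow> 'g::ab_group_add \<Rightarrow> 'g"
  assumes "n \<in> sym_ideal scaleG UNIV"
  shows "lin_ext pscale symmetrize n \<in> env_ideal scaleG bracket"
proof (rule sym_ideal_mapped[OF linear_lin_ext_pscale subspace_env_ideal _ _ _ assms])
  let ?E = "env_ideal scaleG bracket"
  let ?P = "\<lambda>u v. {\<sigma>. \<sigma> permutes {..<Suc (length u + length v)}}"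
  note S = pm.subspace_scale[OF subspace_env_ideal] pm.subspace_sum[OF subspace_env_ideal]
  fix u v :: "'g list" and x y c
  let ?k = "1 / fact (Suc (length u + length v))"
  have sym: "symmetrize (u @ [z] @ v) = pscale ?k
      (\<Sum>\<sigma>\<in>?P u v. Poly_Mapping.single (permute_list \<sigma> (u @ [z] @ v)) (1::'k))" for z
    by (simp add: symmetrize_def)
  have "Poly_Mapping.single (permute_list \<sigma> (u @ [x + y] @ v)) 1
      - Poly_Mapping.single (permute_list \<sigma> (u @ [x] @ v)) 1
      - Poly_Mapping.single (permute_list \<sigma> (u @ [y] @ v)) 1 \<in> ?E"
    "Poly_Mapping.single (permute_list \<sigma> (u @ [scaleG c x] @ v)) 1
      - pscale c (Poly_Mapping.single (permute_list \<sigma> (u @ [x] @ v)) 1) \<in> ?E" if "\<sigma> \<in> ?P u v" for \<sigma>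
  proof -
    obtain a b where "\<And>z. permute_list \<sigma> (u @ [z] @ v) = a @ [z] @ b"
      using \<open>\<sigma> \<in> ?P u v\<close> permute_list_slot by blast
    with env_ideal_relations[where u = a and v = b]
    show "Poly_Mapping.single (permute_list \<sigma> (u @ [x + y] @ v)) 1
      - Poly_Mapping.single (permute_list \<sigma> (u @ [x] @ v)) 1
      - Poly_Mapping.single (permute_list \<sigma> (u @ [y] @ v)) 1 \<in> ?E"
      "Poly_Mapping.single (permute_list \<sigma> (u @ [scaleG c x] @ v)) 1
      - pscale c (Poly_Mapping.single (permute_list \<sigma> (u @ [x] @ v)) 1) \<in> ?E" by simp_all
  qed
  note * = this
  have "symmetrize (u @ [x + y] @ v) - symmetrize (u @ [x] @ v) - symmetrize (u @ [y] @ v) \<in> ?E"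
    unfolding sym pm.scale_right_diff_distrib[symmetric] sum_subtractf[symmetric] by (intro S *)
  then show "lin_ext pscale symmetrize (Poly_Mapping.single (u @ [x + y] @ v) 1)
      - lin_ext pscale symmetrize (Poly_Mapping.single (u @ [x] @ v) 1)
      - lin_ext pscale symmetrize (Poly_Mapping.single (u @ [y] @ v) 1) \<in> ?E"
    by (simp only: lin_ext_pscale_single pm.scale_one)
  have "symmetrize (u @ [scaleG c x] @ v) - pscale c (symmetrize (u @ [x] @ v)) \<in> ?E"
    unfolding sym pm.scale_left_commute[of c] pm.scale_sum_right[of c]
      pm.scale_right_diff_distrib[symmetric] sum_subtractf[symmetric] by (intro S *)
  then show "lin_ext pscale symmetrize (Poly_Mapping.single (u @ [scaleG c x] @ v) 1)
      - pscale c (lin_ext pscale symmetrize (Poly_Mapping.single (u @ [x] @ v) 1)) \<in> ?E"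
    by (simp only: lin_ext_pscale_single pm.scale_one)
  obtain \<tau> where "\<tau> permutes {..<length (u @ [x, y] @ v)}"
    "permute_list \<tau> (u @ [x, y] @ v) = u @ [y, x] @ v"
    by (rule mset_eq_permutation[of "u @ [y, x] @ v" "u @ [x, y] @ v"]) simp_all
  then have "symmetrize (u @ [y, x] @ v) = (symmetrize (u @ [x, y] @ v) :: 'g list \<Rightarrow>\<^sub>0 'k)"
    by (metis symmetrize_permute)
  then show "lin_ext pscale symmetrize (Poly_Mapping.single (u @ [x, y] @ v) 1)
      - lin_ext pscale symmetrize (Poly_Mapping.single (u @ [y, x] @ v) 1) \<in> ?E"
    using pm.subspace_0[OF subspace_env_ideal] by (simp only: lin_ext_pscale_single pm.scale_one diff_self)
qed

lemma PBW_coset: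
  "PBW scaleG bracket (p +o sym_ideal scaleG UNIV) = lin_ext pscale symmetrize p +o env_ideal scaleG bracket"
  unfolding PBW_def
  by (intro induced_coset_linear linear_lin_ext_pscale subspace_sym_ideal subspace_env_ideal
    symmetrize_sym_ideal)

lemma ad_word_append:
  "ad_word bracket x (u @ v) = ad_word bracket x u * Poly_Mapping.single v 1
    + Poly_Mapping.single u 1 * ad_word bracket x v"
proof -
  have "(\<Sum>i<m + n. f i) = (\<Sum>i<m. f i) + (\<Sum>i<n. f (m + i))"
    for f :: "nat \<Rightarrow> 'a list \<Rightarrow>\<^sub>0 'b" and m n
    by (induction n) (simp_all add: add.assoc)
  then show ?thesis
    by (simp add: ad_word_def sum_distrib_left sum_distrib_right list_update_append nth_append)
qed

lemma ad_derivation: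
  "lin_ext pscale (ad_word bracket x) (p * q) =
    lin_ext pscale (ad_word bracket x) p * q + p * lin_ext pscale (ad_word bracket x) q"
    (is "?D (p * q) = _")
proof -
  note L = lin_map_add[OF linear_lin_ext_pscale]
  have 1: "?D (Poly_Mapping.single u c * Poly_Mapping.single v d) =
      ?D (Poly_Mapping.single u c) * Poly_Mapping.single v d
        + Poly_Mapping.single u c * ?D (Poly_Mapping.single v d)" for u v c d
  proof -
    have "?D (Poly_Mapping.single u c * Poly_Mapping.single v d) =
      pscale c (ad_word bracket x u) * pscale d (Poly_Mapping.single v 1)
        + pscale c (Poly_Mapping.single u 1) * pscale d (ad_word bracket x v)"
      unfolding single_mult_single lin_ext_pscale_single ad_word_append pm.scale_right_distrib
      by (simp only: pscale_mult_left[symmetric] pscale_mult_right[symmetric] pm.scale_scale ac_simps)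
    then show ?thesis by simp
  qed
  have U: "r \<in> free_on UNIV" for r :: "'a list \<Rightarrow>\<^sub>0 'b" by (simp add: free_on_def)
  have 2: "?D (Poly_Mapping.single u c * q) =
      ?D (Poly_Mapping.single u c) * q + Poly_Mapping.single u c * ?D q" for u c
    using U[of q] by (induction rule: free_on_induct)
      (simp_all only: 1 distrib_left L ac_simps, simp add: lin_ext_def)
  show ?thesis
    using U[of p] by (induction rule: free_on_induct)
      (simp_all only: 2 distrib_right L ac_simps, simp add: lin_ext_def)
qed

lemma ad_letter: "lin_ext pscale (ad_word bracket x) (letter y) = letter (bracket x y)"
  by (simp add: letter_def ad_word_def)

lemma ad_two_sided_ideal:
  assumes "\<And>r. r \<in> R \<Longrightarrow> lin_ext pscale (ad_word bracket x) r \<in> two_sided_ideal UNIV R"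
    and "n \<in> two_sided_ideal UNIV R"
  shows "lin_ext pscale (ad_word bracket x) n \<in> two_sided_ideal UNIV R"
proof (rule linear_maps_ideal[OF linear_lin_ext_pscale subspace_ideal _ assms(2)])
  fix u r v assume "r \<in> R"
  then show "lin_ext pscale (ad_word bracket x) (Poly_Mapping.single u 1 * r * Poly_Mapping.single v 1)
      \<in> two_sided_ideal UNIV R"
    unfolding ad_derivation distrib_right
    by (intro pm.subspace_add[OF subspace_ideal] ideal_mult_UNIV assms(1))
      (auto simp: mult.assoc intro!: ideal_mult_UNIV in_two_sided_ideal)
qed

context lie_algebra
begin

lemma bracket_add_right: "bracket x (y + z) = bracket x y + bracket x z"
  and bracket_scale_right: "bracket x (scaleG c y) = scaleG c (bracket x y)"
  using bracket_linear_right[of x] by (simp_all add: Vector_Spaces.linear_iff)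

lemma bracket_add_left: "bracket (x + y) z = bracket x z + bracket y z"
  using bracket_linear_left[of z] by (simp add: Vector_Spaces.linear_iff)

lemma bracket_antisym: "bracket y x = - bracket x y"
proof -
  have "bracket x y + bracket y x = 0"
    using bracket_self[of "x + y", unfolded bracket_add_left bracket_add_right]
    by (simp add: bracket_self add.commute)
  then show ?thesis by (simp add: eq_neg_iff_add_eq_0 add.commute[of "bracket y x"])
qed

lemma bracket_derivation: "bracket x (bracket y z) = bracket (bracket x y) z + bracket y (bracket x z)"
proof -
  have "bracket y (bracket z x) = - bracket y (bracket x z)"
    using lin_map_scale[OF bracket_linear_right, of y "-1" "bracket x z"] bracket_antisym[of z x]
    by simp
  moreover have "bracket z (bracket x y) = - bracket (bracket x y) z"
    by (rule bracket_antisym)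
  ultimately show ?thesis
    using jacobi[of x y z] by (simp add: algebra_simps)
qed

lemma ad_linear_relators:
  "r \<in> linear_relators scaleG UNIV \<Longrightarrow>
    lin_ext pscale (ad_word bracket x) r \<in> linear_relators scaleG UNIV"
proof -
  have "lin_ext pscale (ad_word bracket x) (letter (y + z) - letter y - letter z)
      = letter (bracket x y + bracket x z) - letter (bracket x y) - letter (bracket x z)" for y z
    by (simp add: ad_letter lin_map_diff[OF linear_lin_ext_pscale] bracket_add_right)
  moreover have "lin_ext pscale (ad_word bracket x) (letter (scaleG c y) - pscale c (letter y))
      = letter (scaleG c (bracket x y)) - pscale c (letter (bracket x y))" for c y
    by (simp add: ad_letter lin_map_diff[OF linear_lin_ext_pscale] lin_map_scale[OF linear_lin_ext_pscale]
        bracket_scale_right)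
  moreover assume "r \<in> linear_relators scaleG UNIV"
  ultimately show ?thesis unfolding linear_relators_def by fastforce
qed

lemma ad_sym_ideal:
  assumes "n \<in> sym_ideal scaleG UNIV"
  shows "lin_ext pscale (ad_word bracket x) n \<in> sym_ideal scaleG UNIV"
proof -
  let ?D = "lin_ext pscale (ad_word bracket x)"
  let ?C = "{letter x * letter y - letter y * letter x :: 'g list \<Rightarrow>\<^sub>0 'k | x y. x \<in> UNIV \<and> y \<in> UNIV}"
  let ?I = "two_sided_ideal UNIV (linear_relators scaleG UNIV \<union> ?C)"
  have C: "letter y * letter z - letter z * letter y \<in> ?I" for y z
    by (rule in_two_sided_ideal) blast
  have "?D r \<in> ?I" if "r \<in> linear_relators scaleG UNIV \<union> ?C" for r
    using that
  proof
    assume "r \<in> ?C"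
    then obtain y z where r: "r = letter y * letter z - letter z * letter y" by blast
    have "?D r = (letter (bracket x y) * letter z - letter z * letter (bracket x y))
        + (letter y * letter (bracket x z) - letter (bracket x z) * letter y)"
      by (simp add: r lin_map_diff[OF linear_lin_ext_pscale] ad_derivation ad_letter)
    also have "\<dots> \<in> ?I" by (intro pm.subspace_add[OF subspace_ideal] C)
    finally show ?thesis .
  qed (blast intro: in_two_sided_ideal ad_linear_relators)
  then show ?thesis
    using assms unfolding sym_ideal_def by (rule ad_two_sided_ideal)
qed

lemma ad_env_ideal:
  assumes "n \<in> env_ideal scaleG bracket"
  shows "lin_ext pscale (ad_word bracket x) n \<in> env_ideal scaleG bracket"
proof -
  let ?D = "lin_ext pscale (ad_word bracket x)"
  let ?C = "{letter x * letter y - letter y * letter x - letter (bracket x y) :: 'g list \<Rightarrow>\<^sub>0 'k | x y. True}"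
  let ?I = "two_sided_ideal UNIV (linear_relators scaleG UNIV \<union> ?C)"
  have C: "letter y * letter z - letter z * letter y - letter (bracket y z) \<in> ?I" for y z
    by (rule in_two_sided_ideal) blast
  have A: "letter (y + z) - letter y - letter z \<in> ?I" for y z
    by (rule in_two_sided_ideal) (auto simp: linear_relators_def)
  have "?D r \<in> ?I" if "r \<in> linear_relators scaleG UNIV \<union> ?C" for r
    using that
  proof
    assume "r \<in> ?C"
    then obtain y z where r: "r = letter y * letter z - letter z * letter y - letter (bracket y z)" by blast
    have "?D r = (letter (bracket x y) * letter z - letter z * letter (bracket x y) - letter (bracket (bracket x y) z))
        + (letter y * letter (bracket x z) - letter (bracket x z) * letter y - letter (bracket y (bracket x z)))
        - (letter (bracket (bracket x y) z + bracket y (bracket x z)) - letter (bracket (bracket x y) z)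
          - letter (bracket y (bracket x z)))"
      by (simp add: r lin_map_diff[OF linear_lin_ext_pscale] ad_derivation ad_letter
          flip: bracket_derivation[of x y z])
    also have "\<dots> \<in> ?I"
      by (rule pm.subspace_diff[OF subspace_ideal pm.subspace_add[OF subspace_ideal C C] A])
    finally show ?thesis .
  qed (blast intro: in_two_sided_ideal ad_linear_relators)
  then show ?thesis
    using assms unfolding env_ideal_def by (rule ad_two_sided_ideal)
qed

lemma ad_action_sym_coset:
  "ad_action (sym_ideal scaleG UNIV) bracket x (p +o sym_ideal scaleG UNIV) =
    lin_ext pscale (ad_word bracket x) p +o sym_ideal scaleG UNIV"
  unfolding ad_action_def
  by (intro induced_coset_linear linear_lin_ext_pscale subspace_sym_ideal ad_sym_ideal)

lemma ad_action_env_coset: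
  "ad_action (env_ideal scaleG bracket) bracket x (p +o env_ideal scaleG bracket) =
    lin_ext pscale (ad_word bracket x) p +o env_ideal scaleG bracket"
  unfolding ad_action_def
  by (intro induced_coset_linear linear_lin_ext_pscale subspace_env_ideal ad_env_ideal)

end

context lie_representation
begin

lemma linear_foldr_rho: "Vector_Spaces.linear scaleV scaleV (foldr rho w)"
proof (induction w)
  case Nil
  show ?case by (simp add: Vector_Spaces.linear_iff V.vector_space_axioms)
next
  case (Cons x w)
  then show ?case using rho_linear_right[of x] by (simp add: Vector_Spaces.linear_iff)
qed

lemma env_act_coset:
  "env_act scaleV rho (p +o env_ideal scaleG bracket) = (\<lambda>v. lin_ext scaleV (\<lambda>w. foldr rho w v) p)"
  unfolding env_act_def
proof (rule induced_coset)
  fix n assume n: "n \<in> env_ideal scaleG bracket"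
  have L: "Vector_Spaces.linear pscale scaleV (lin_ext scaleV (\<lambda>w. foldr rho w v))" for v
    by (rule linear_lin_ext) (rule V.vector_space_axioms)
  have "lin_ext scaleV (\<lambda>w. foldr rho w v) n \<in> {0}" for v
  proof (rule env_ideal_mapped[OF L _ _ _ _ n])
    show "V.subspace {0}" by simp
  qed (simp_all add: lin_ext_single[OF V.vector_space_axioms] rho_bracket lin_map_add[OF rho_linear_left]
      lin_map_scale[OF rho_linear_left] lin_map_add[OF linear_foldr_rho]
      lin_map_scale[OF linear_foldr_rho] lin_map_diff[OF linear_foldr_rho])
  then show "(\<lambda>v. lin_ext scaleV (\<lambda>w. foldr rho w v) (p + n)) = (\<lambda>v. lin_ext scaleV (\<lambda>w. foldr rho w v) p)"
    by (simp add: lin_map_add[OF L])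
qed (rule pm.subspace_0[OF subspace_env_ideal])

end

subsection \<open>The pairing\<close>

lemma vector_space_field: "vector_space ((*) :: 'k::field \<Rightarrow> 'k \<Rightarrow> 'k)"
  by unfold_locales (simp_all add: algebra_simps)

lemma subspace_zero:
  assumes "vector_space scale" shows "module.subspace scale {0}"
proof -
  interpret vector_space scale by fact
  show ?thesis by (rule subspace_single_0)
qed

lemma word_pairing_swap:
  assumes "length \<xi>s = length xs"
  shows "word_pairing \<xi>s xs =
    (\<Sum>\<sigma> | \<sigma> permutes {..<length xs}. \<Prod>i<length xs. (\<xi>s ! \<sigma> i) (xs ! i))"
proof -
  let ?N = "{..<length xs}"
  have "(\<Sum>\<sigma> | \<sigma> permutes ?N. \<Prod>i\<in>?N. (\<xi>s ! i) (xs ! \<sigma> i)) =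
      (\<Sum>\<sigma> | \<sigma> permutes ?N. \<Prod>i\<in>?N. (\<xi>s ! i) (xs ! inv \<sigma> i))"
    by (rule sum_permutations_inverse)
  also have "\<dots> = (\<Sum>\<sigma> | \<sigma> permutes ?N. \<Prod>i\<in>?N. (\<xi>s ! \<sigma> i) (xs ! i))"
  proof (rule sum.cong[OF refl])
    fix \<sigma> assume "\<sigma> \<in> {\<sigma>. \<sigma> permutes ?N}"
    then have s: "\<sigma> permutes ?N" by simp
    show "(\<Prod>i\<in>?N. (\<xi>s ! i) (xs ! inv \<sigma> i)) = (\<Prod>i\<in>?N. (\<xi>s ! \<sigma> i) (xs ! i))"
      by (subst prod.permute[OF s]) (simp add: o_def permutes_inverses(2)[OF s])
  qed
  finally show ?thesis using assms by (simp add: word_pairing_def)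
qed

lemma word_pairing_permute_left:
  assumes "\<tau> permutes {..<length \<xi>s}"
  shows "word_pairing (permute_list \<tau> \<xi>s) xs = word_pairing \<xi>s xs"
proof (cases "length \<xi>s = length xs")
  case True
  let ?N = "{..<length xs}"
  have t: "\<tau> permutes ?N" using assms True by simp
  have "word_pairing (permute_list \<tau> \<xi>s) xs =
      (\<Sum>\<sigma> | \<sigma> permutes ?N. \<Prod>i\<in>?N. (permute_list \<tau> \<xi>s ! \<sigma> i) (xs ! i))"
    using True by (intro word_pairing_swap) simp
  also have "\<dots> = (\<Sum>\<sigma> | \<sigma> permutes ?N. \<Prod>i\<in>?N. (\<xi>s ! (\<tau> \<circ> \<sigma>) i) (xs ! i))"
  proof (intro sum.cong prod.cong refl)
    fix \<sigma> i assume "\<sigma> \<in> {\<sigma>. \<sigma> permutes ?N}" "i \<in> ?N"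
    then have "\<sigma> i < length \<xi>s" using True permutes_in_image[of \<sigma> ?N i] by simp
    then show "(permute_list \<tau> \<xi>s ! \<sigma> i) (xs ! i) = (\<xi>s ! (\<tau> \<circ> \<sigma>) i) (xs ! i)"
      using assms by (simp add: permute_list_nth)
  qed
  also have "\<dots> = word_pairing \<xi>s xs"
    unfolding word_pairing_swap[OF True] by (rule setum_permutations_compose_left[OF t, symmetric])
  finally show ?thesis .
qed (simp add: word_pairing_def)

lemma word_pairing_permute_right:
  assumes "\<tau> permutes {..<length xs}"
  shows "word_pairing \<xi>s (permute_list \<tau> xs) = word_pairing \<xi>s xs"
proof (cases "length \<xi>s = length xs")
  case True
  let ?N = "{..<length xs}"
  have "word_pairing \<xi>s (permute_list \<tau> xs) =
      (\<Sum>\<sigma> | \<sigma> permutes ?N. \<Prod>i\<in>?N. (\<xi>s ! i) (permute_list \<tau> xs ! \<sigma> i))"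
    using True by (simp add: word_pairing_def)
  also have "\<dots> = (\<Sum>\<sigma> | \<sigma> permutes ?N. \<Prod>i\<in>?N. (\<xi>s ! i) (xs ! (\<tau> \<circ> \<sigma>) i))"
  proof (intro sum.cong prod.cong refl)
    fix \<sigma> i assume "\<sigma> \<in> {\<sigma>. \<sigma> permutes ?N}" "i \<in> ?N"
    then have "\<sigma> i < length xs" using permutes_in_image[of \<sigma> ?N i] by simp
    then show "(\<xi>s ! i) (permute_list \<tau> xs ! \<sigma> i) = (\<xi>s ! i) (xs ! (\<tau> \<circ> \<sigma>) i)"
      using assms by (simp add: permute_list_nth)
  qed
  also have "\<dots> = word_pairing \<xi>s xs"
    unfolding word_pairing_def if_P[OF True] by (rule setum_permutations_compose_left[OF assms, symmetric])
  finally show ?thesis .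
qed (simp add: word_pairing_def)

lemma word_pairing_slot_left:
  obtains S :: "(nat \<Rightarrow> nat) set" and g C where "\<And>\<xi>. word_pairing (u @ [\<xi>] @ v) xs = (\<Sum>\<sigma>\<in>S. \<xi> (g \<sigma>) * C \<sigma>)"
proof (cases "Suc (length u + length v) = length xs")
  case True
  let ?N = "{..<length xs}" and ?k = "length u"
  have "(\<Prod>i\<in>?N. ((u @ [\<xi>] @ v) ! i) (xs ! \<sigma> i)) =
      \<xi> (xs ! \<sigma> ?k) * (\<Prod>i\<in>?N - {?k}. ((u @ [undefined] @ v) ! i) (xs ! \<sigma> i))" for \<xi> \<sigma>
  proof -
    have "?k \<in> ?N" using True by simp
    moreover have "(u @ [\<xi>] @ v) ! i = (u @ [undefined] @ v) ! i" if "i \<in> ?N - {?k}" for i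
      using that by (auto simp: nth_append nth_Cons split: nat.splits)
    ultimately show ?thesis by (simp add: prod.remove[of ?N ?k])
  qed
  then show ?thesis
    using True by (intro that[where S = "{\<sigma>. \<sigma> permutes ?N}" and g = "\<lambda>\<sigma>. xs ! \<sigma> ?k"
      and C = "\<lambda>\<sigma>. \<Prod>i\<in>?N - {?k}. ((u @ [undefined] @ v) ! i) (xs ! \<sigma> i)"]) (simp add: word_pairing_def)
next
  case False
  then show ?thesis by (intro that[where S = "{}"]) (simp add: word_pairing_def)
qed

lemma word_pairing_slot_right:
  obtains S :: "(nat \<Rightarrow> nat) set" and h C where "\<And>\<sigma>. \<sigma> \<in> S \<Longrightarrow> h \<sigma> \<in> set \<xi>s"
    "\<And>x. word_pairing \<xi>s (u @ [x] @ v) = (\<Sum>\<sigma>\<in>S. h \<sigma> x * C \<sigma>)"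
proof (cases "length \<xi>s = Suc (length u + length v)")
  case True
  let ?N = "{..<Suc (length u + length v)}" and ?k = "length u"
  have "(\<Prod>i\<in>?N. (\<xi>s ! \<sigma> i) ((u @ [x] @ v) ! i)) =
      (\<xi>s ! \<sigma> ?k) x * (\<Prod>i\<in>?N - {?k}. (\<xi>s ! \<sigma> i) ((u @ [undefined] @ v) ! i))" for x \<sigma>
  proof -
    have "?k \<in> ?N" by simp
    moreover have "(u @ [x] @ v) ! i = (u @ [undefined] @ v) ! i" if "i \<in> ?N - {?k}" for i
      using that by (auto simp: nth_append nth_Cons split: nat.splits)
    ultimately show ?thesis
      by (subst prod.remove[of ?N ?k]) (simp_all add: nth_append del: prod.lessThan_Suc append.simps)
  qed
  moreover have "\<xi>s ! \<sigma> ?k \<in> set \<xi>s" if "\<sigma> permutes ?N" for \<sigma>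
    using True permutes_in_image[OF that, of ?k] by simp
  ultimately show ?thesis
    using True by (intro that[where S = "{\<sigma>. \<sigma> permutes ?N}" and h = "\<lambda>\<sigma>. \<xi>s ! \<sigma> ?k"
      and C = "\<lambda>\<sigma>. \<Prod>i\<in>?N - {?k}. (\<xi>s ! \<sigma> i) ((u @ [undefined] @ v) ! i)"])
      (simp_all add: word_pairing_swap del: prod.lessThan_Suc)
next
  case False
  then show ?thesis by (intro that[where S = "{}"]) (auto simp: word_pairing_def)
qed

lemma word_pairing_linear_left:
  "word_pairing (u @ [\<xi> + \<eta>] @ v) xs = word_pairing (u @ [\<xi>] @ v) xs + word_pairing (u @ [\<eta>] @ v) xs"
  "word_pairing (u @ [dual_scale c \<xi>] @ v) xs = c * word_pairing (u @ [\<xi>] @ v) xs"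
proof -
  obtain S :: "(nat \<Rightarrow> nat) set" and g C where *: "\<And>\<xi>. word_pairing (u @ [\<xi>] @ v) xs = (\<Sum>\<sigma>\<in>S. \<xi> (g \<sigma>) * C \<sigma>)"
    by (rule word_pairing_slot_left[of u v xs]) (rule that)
  show "word_pairing (u @ [\<xi> + \<eta>] @ v) xs = word_pairing (u @ [\<xi>] @ v) xs + word_pairing (u @ [\<eta>] @ v) xs"
    unfolding * by (simp add: distrib_right sum.distrib)
  show "word_pairing (u @ [dual_scale c \<xi>] @ v) xs = c * word_pairing (u @ [\<xi>] @ v) xs"
    unfolding * by (simp add: dual_scale_def sum_distrib_left mult.assoc)
qed

lemma word_pairing_linear_right:
  assumes "\<xi>s \<in> lists (dual_space scaleG)"
  shows "word_pairing \<xi>s (u @ [x + y] @ v) = word_pairing \<xi>s (u @ [x] @ v) + word_pairing \<xi>s (u @ [y] @ v)"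
    and "word_pairing \<xi>s (u @ [scaleG c x] @ v) = c * word_pairing \<xi>s (u @ [x] @ v)"
proof -
  obtain S :: "(nat \<Rightarrow> nat) set" and h C where h: "\<And>\<sigma>. \<sigma> \<in> S \<Longrightarrow> h \<sigma> \<in> set \<xi>s"
    and *: "\<And>x. word_pairing \<xi>s (u @ [x] @ v) = (\<Sum>\<sigma>\<in>S. h \<sigma> x * C \<sigma>)"
    using word_pairing_slot_right[of \<xi>s u v] by blast
  have L: "Vector_Spaces.linear scaleG (*) (h \<sigma>)" if "\<sigma> \<in> S" for \<sigma>
    using h[OF that] assms by (auto simp: dual_space_def Hom_def)
  show "word_pairing \<xi>s (u @ [x + y] @ v) = word_pairing \<xi>s (u @ [x] @ v) + word_pairing \<xi>s (u @ [y] @ v)"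
    unfolding * by (simp add: lin_map_add[OF L] distrib_right sum.distrib)
  show "word_pairing \<xi>s (u @ [scaleG c x] @ v) = c * word_pairing \<xi>s (u @ [x] @ v)"
    unfolding * by (simp add: lin_map_scale[OF L] sum_distrib_left mult.assoc)
qed

lemma permute_swap:
  obtains \<tau> where "\<tau> permutes {..<length (u @ [x, y] @ v)}" "permute_list \<tau> (u @ [x, y] @ v) = u @ [y, x] @ v"
  by (rule mset_eq_permutation[of "u @ [y, x] @ v" "u @ [x, y] @ v"]) simp_all

lemma subspace_field_zero: "module.subspace ((*) :: 'k::field \<Rightarrow> 'k \<Rightarrow> 'k) {0}"
  by (rule subspace_zero) (rule vector_space_field)

definition free_pairing :: "(('g \<Rightarrow> 'k::field) list \<Rightarrow>\<^sub>0 'k) \<Rightarrow> ('g list \<Rightarrow>\<^sub>0 'k) \<Rightarrow> 'k"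
  where "free_pairing p q = lin_ext (*) (\<lambda>\<xi>s. lin_ext (*) (word_pairing \<xi>s) q) p"

lemma linear_free_pairing_left: "Vector_Spaces.linear pscale (*) (\<lambda>p. free_pairing p q)"
  unfolding free_pairing_def by (rule linear_lin_ext) (rule vector_space_field)

lemma linear_free_pairing_right: "Vector_Spaces.linear pscale (*) (free_pairing p)"
proof -
  have L: "Vector_Spaces.linear pscale (*) (lin_ext (*) (word_pairing \<xi>s))" for \<xi>s :: "('b \<Rightarrow> 'a) list"
    by (rule linear_lin_ext) (rule vector_space_field)
  show ?thesis
    unfolding Vector_Spaces.linear_iff
  proof (intro conjI allI)
    fix q r c
    show "free_pairing p (q + r) = free_pairing p q + free_pairing p r"
      by (simp add: free_pairing_def lin_ext_def[of _ _ p] lin_map_add[OF L] distrib_left sum.distrib)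
    show "free_pairing p (pscale c q) = c * free_pairing p q"
      by (simp add: free_pairing_def lin_ext_def[of _ _ p] lin_map_scale[OF L] sum_distrib_left mult.left_commute)
  qed (rule pm.vector_space_axioms vector_space_field)+
qed

lemma free_pairing_ideal_left:
  assumes "n \<in> sym_ideal dual_scale W" shows "free_pairing n q = 0"
proof -
  have "free_pairing n q \<in> {0}"
  proof (rule sym_ideal_mapped[OF linear_free_pairing_left subspace_field_zero _ _ _ assms])
    fix u v :: "('a \<Rightarrow> 'b) list" and \<xi> \<eta> :: "'a \<Rightarrow> 'b" and c
    have S: "free_pairing (Poly_Mapping.single w 1) q = lin_ext (*) (word_pairing w) q" for w
      by (simp add: free_pairing_def lin_ext_single[OF vector_space_field])
    show "free_pairing (Poly_Mapping.single (u @ [\<xi> + \<eta>] @ v) 1) q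
        - free_pairing (Poly_Mapping.single (u @ [\<xi>] @ v) 1) q
        - free_pairing (Poly_Mapping.single (u @ [\<eta>] @ v) 1) q \<in> {0}"
      unfolding S lin_ext_def word_pairing_linear_left by (simp add: distrib_left sum.distrib)
    show "free_pairing (Poly_Mapping.single (u @ [dual_scale c \<xi>] @ v) 1) q
        - c * free_pairing (Poly_Mapping.single (u @ [\<xi>] @ v) 1) q \<in> {0}"
      unfolding S lin_ext_def word_pairing_linear_left by (simp add: sum_distrib_left ac_simps)
    obtain \<tau> where t: "\<tau> permutes {..<length (u @ [\<xi>, \<eta>] @ v)}"
      "permute_list \<tau> (u @ [\<xi>, \<eta>] @ v) = u @ [\<eta>, \<xi>] @ v" using permute_swap .
    have "word_pairing (u @ [\<eta>, \<xi>] @ v) = word_pairing (u @ [\<xi>, \<eta>] @ v)"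
      using word_pairing_permute_left[OF t(1)] unfolding t(2) by (intro ext)
    then show "free_pairing (Poly_Mapping.single (u @ [\<xi>, \<eta>] @ v) 1) q
        - free_pairing (Poly_Mapping.single (u @ [\<eta>, \<xi>] @ v) 1) q \<in> {0}"
      unfolding S by simp
  qed
  then show ?thesis by simp
qed

lemma free_pairing_ideal_right:
  assumes "p \<in> free_on (lists (dual_space scaleG))" "m \<in> sym_ideal scaleG UNIV"
  shows "free_pairing p m = 0"
proof -
  have "lin_ext (*) (word_pairing \<xi>s) m \<in> {0}" if "\<xi>s \<in> Poly_Mapping.keys p" for \<xi>s
  proof (rule sym_ideal_mapped[OF linear_lin_ext[OF vector_space_field] subspace_field_zero _ _ _ assms(2)])
    have *: "\<xi>s \<in> lists (dual_space scaleG)" using that assms(1) by (auto simp: free_on_def)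
    fix u v x y c
    have S: "lin_ext (*) (word_pairing \<xi>s) (Poly_Mapping.single w 1) = word_pairing \<xi>s w" for w
      by (simp add: lin_ext_single[OF vector_space_field])
    show "lin_ext (*) (word_pairing \<xi>s) (Poly_Mapping.single (u @ [x + y] @ v) 1)
        - lin_ext (*) (word_pairing \<xi>s) (Poly_Mapping.single (u @ [x] @ v) 1)
        - lin_ext (*) (word_pairing \<xi>s) (Poly_Mapping.single (u @ [y] @ v) 1) \<in> {0}"
      unfolding S word_pairing_linear_right[OF *] by simp
    show "lin_ext (*) (word_pairing \<xi>s) (Poly_Mapping.single (u @ [scaleG c x] @ v) 1)
        - c * lin_ext (*) (word_pairing \<xi>s) (Poly_Mapping.single (u @ [x] @ v) 1) \<in> {0}"
      unfolding S word_pairing_linear_right[OF *] by simp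
    obtain \<tau> where t: "\<tau> permutes {..<length (u @ [x, y] @ v)}"
      "permute_list \<tau> (u @ [x, y] @ v) = u @ [y, x] @ v" using permute_swap .
    have "word_pairing \<xi>s (u @ [y, x] @ v) = word_pairing \<xi>s (u @ [x, y] @ v)"
      using word_pairing_permute_right[OF t(1)] unfolding t(2) .
    then show "lin_ext (*) (word_pairing \<xi>s) (Poly_Mapping.single (u @ [x, y] @ v) 1)
        - lin_ext (*) (word_pairing \<xi>s) (Poly_Mapping.single (u @ [y, x] @ v) 1) \<in> {0}"
      unfolding S by simp
  qed
  then show ?thesis by (simp add: free_pairing_def lin_ext_def[of _ _ p])
qed

lemma pairing_coset:
  assumes "p \<in> free_on (lists (dual_space scaleG))"
  shows "pairing (p +o Sdual_ideal scaleG) (q +o sym_ideal scaleG UNIV) = free_pairing p q"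
  unfolding pairing_def free_pairing_def[symmetric]
proof (rule induced2_coset)
  fix n m assume "n \<in> Sdual_ideal scaleG" "m \<in> sym_ideal scaleG UNIV"
  then show "free_pairing (p + n) (q + m) = free_pairing p q"
    using assms by (simp add: lin_map_add[OF linear_free_pairing_left] lin_map_add[OF linear_free_pairing_right]
      free_pairing_ideal_left free_pairing_ideal_right)
qed (simp_all add: pm.subspace_0[OF subspace_sym_ideal])

subsection \<open>Tensor products, \<open>\<Lambda>\<close> and the contraction\<close>

lemma subspace_tensor: "pm.subspace (tensor_relations scaleV B addB scaleB)"
  by (simp add: tensor_relations_def pm.subspace_span)

lemma tensor_relationsI:
  "b \<in> B \<Longrightarrow> Poly_Mapping.single (u + v, b) 1 - Poly_Mapping.single (u, b) 1 - Poly_Mapping.single (v, b) 1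
    \<in> tensor_relations scaleV B addB scaleB"
  "b \<in> B \<Longrightarrow> Poly_Mapping.single (scaleV c v, b) 1 - Poly_Mapping.single (v, b) c
    \<in> tensor_relations scaleV B addB scaleB"
  "a \<in> B \<Longrightarrow> b \<in> B \<Longrightarrow>
    Poly_Mapping.single (v, addB a b) 1 - Poly_Mapping.single (v, a) 1 - Poly_Mapping.single (v, b) 1
    \<in> tensor_relations scaleV B addB scaleB"
  "b \<in> B \<Longrightarrow> Poly_Mapping.single (v, scaleB c b) 1 - Poly_Mapping.single (v, b) c
    \<in> tensor_relations scaleV B addB scaleB"
  unfolding tensor_relations_def by (rule pm.span_base; blast)+

lemma tensor_relations_mapped:
  fixes g :: "'v::ab_group_add \<times> 'b \<Rightarrow> 'c::ab_group_add" and scaleV :: "'k::field \<Rightarrow> 'v \<Rightarrow> 'v"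
  assumes scale: "vector_space scale" and M: "module.subspace scale M"
    and "\<And>u v b. b \<in> B \<Longrightarrow> g (u + v, b) - g (u, b) - g (v, b) \<in> M"
    and "\<And>c v b. b \<in> B \<Longrightarrow> g (scaleV c v, b) - scale c (g (v, b)) \<in> M"
    and "\<And>v a b. a \<in> B \<Longrightarrow> b \<in> B \<Longrightarrow> g (v, addB a b) - g (v, a) - g (v, b) \<in> M"
    and "\<And>c v b. b \<in> B \<Longrightarrow> g (v, scaleB c b) - scale c (g (v, b)) \<in> M"
    and n: "n \<in> tensor_relations scaleV B addB scaleB"
  shows "lin_ext scale g n \<in> M"
proof -
  interpret S: vector_space scale by fact
  note L = linear_lin_ext[OF scale, of g]
  show ?thesis
    by (rule linear_maps_span[OF L M _ n[unfolded tensor_relations_def]])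
      (use assms(3-6) in \<open>auto simp: lin_map_diff[OF L] lin_ext_single[OF scale]\<close>)
qed

lemma dual_space_closed:
  "\<xi> \<in> dual_space scaleG \<Longrightarrow> \<eta> \<in> dual_space scaleG \<Longrightarrow> \<xi> + \<eta> \<in> dual_space scaleG"
  "\<xi> \<in> dual_space scaleG \<Longrightarrow> dual_scale c \<xi> \<in> dual_space scaleG"
  by (auto simp: dual_space_def Hom_def Vector_Spaces.linear_iff dual_scale_def distrib_left)

lemma Sdual_ideal_subset: "Sdual_ideal scaleG \<subseteq> free_on (lists (dual_space scaleG))"
  by (intro sym_ideal_subset_free_on dual_space_closed)

lemma Sdual_mult:
  assumes "p \<in> free_on (lists (dual_space scaleG))" "q \<in> free_on (lists (dual_space scaleG))"
  shows "quot_mult (Sdual_ideal scaleG) (p +o Sdual_ideal scaleG) (q +o Sdual_ideal scaleG)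
    = (p * q) +o Sdual_ideal scaleG"
  using quot_mult_coset[OF assms] Sdual_ideal_subset[of scaleG] by (simp add: sym_ideal_def)

lemma SdualI: "p \<in> free_on (lists (dual_space scaleG)) \<Longrightarrow> p +o Sdual_ideal scaleG \<in> Sdual scaleG"
  by (auto simp: sym_alg_def)

lemma SdualE:
  assumes "f \<in> Sdual scaleG"
  obtains p where "p \<in> free_on (lists (dual_space scaleG))" "f = p +o Sdual_ideal scaleG"
  using assms by (auto simp: sym_alg_def)

lemma letter_dual: "\<xi> \<in> dual_space scaleG \<Longrightarrow> letter \<xi> \<in> free_on (lists (dual_space scaleG))"
  by (simp add: letter_def free_on_def)

lemma Sdual_closed:
  assumes "f \<in> Sdual scaleG"
  shows "g \<in> Sdual scaleG \<Longrightarrow> f + g \<in> Sdual scaleG"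
    and "qscale (Sdual_ideal scaleG) c f \<in> Sdual scaleG"
    and "\<xi> \<in> dual_space scaleG \<Longrightarrow>
      quot_mult (Sdual_ideal scaleG) (letter \<xi> +o Sdual_ideal scaleG) f \<in> Sdual scaleG"
proof -
  obtain p where p: "p \<in> free_on (lists (dual_space scaleG))" "f = p +o Sdual_ideal scaleG"
    using assms by (rule SdualE)
  { assume "g \<in> Sdual scaleG"
    then obtain q where q: "q \<in> free_on (lists (dual_space scaleG))" "g = q +o Sdual_ideal scaleG"
      by (rule SdualE)
    show "f + g \<in> Sdual scaleG"
      unfolding p(2) q(2) coset_add[OF subspace_sym_ideal]
      by (intro SdualI pm.subspace_add[OF subspace_free_on] p q) }
  show "qscale (Sdual_ideal scaleG) c f \<in> Sdual scaleG"
    unfolding p(2) qscale_coset[OF subspace_sym_ideal]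
    by (intro SdualI pm.subspace_scale[OF subspace_free_on] p)
  assume "\<xi> \<in> dual_space scaleG"
  then show "quot_mult (Sdual_ideal scaleG) (letter \<xi> +o Sdual_ideal scaleG) f \<in> Sdual scaleG"
    using p by (simp add: Sdual_mult letter_dual SdualI free_on_mult)
qed

lemma Sdual_mult_linear:
  assumes f: "f \<in> Sdual scaleG" and x: "\<xi> \<in> dual_space scaleG"
  defines "m \<equiv> \<lambda>\<xi>. quot_mult (Sdual_ideal scaleG) (letter \<xi> +o Sdual_ideal scaleG)"
  shows "\<eta> \<in> dual_space scaleG \<Longrightarrow> m (\<xi> + \<eta>) f = m \<xi> f + m \<eta> f"
    and "m (dual_scale c \<xi>) f = qscale (Sdual_ideal scaleG) c (m \<xi> f)"
    and "g \<in> Sdual scaleG \<Longrightarrow> m \<xi> (f + g) = m \<xi> f + m \<xi> g"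
    and "m \<xi> (qscale (Sdual_ideal scaleG) c f) = qscale (Sdual_ideal scaleG) c (m \<xi> f)"
proof -
  obtain p where p: "p \<in> free_on (lists (dual_space scaleG))" "f = p +o Sdual_ideal scaleG"
    using f by (rule SdualE)
  have m: "m \<xi> (q +o Sdual_ideal scaleG) = (letter \<xi> * q) +o Sdual_ideal scaleG"
    if "\<xi> \<in> dual_space scaleG" "q \<in> free_on (lists (dual_space scaleG))" for \<xi> q
    unfolding m_def by (intro Sdual_mult letter_dual that)
  have ideal: "r \<in> linear_relators dual_scale (dual_space scaleG) \<Longrightarrow> r * p \<in> Sdual_ideal scaleG" for r
    using ideal_mult(2)[OF in_two_sided_ideal p(1)] by (auto simp: sym_ideal_def)
  { assume e: "\<eta> \<in> dual_space scaleG"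
    have "letter (\<xi> + \<eta>) - letter \<xi> - letter \<eta> \<in> linear_relators dual_scale (dual_space scaleG)"
      using x e by (auto simp: linear_relators_def)
    from ideal[OF this] show "m (\<xi> + \<eta>) f = m \<xi> f + m \<eta> f"
      unfolding p(2) m[OF x p(1)] m[OF e p(1)] m[OF dual_space_closed(1)[OF x e] p(1)]
        coset_add[OF subspace_sym_ideal] coset_eq_iff[OF subspace_sym_ideal]
      by (simp add: algebra_simps) }
  have "letter (dual_scale c \<xi>) - pscale c (letter \<xi>) \<in> linear_relators dual_scale (dual_space scaleG)"
    using x by (auto simp: linear_relators_def)
  from ideal[OF this] show "m (dual_scale c \<xi>) f = qscale (Sdual_ideal scaleG) c (m \<xi> f)"
    unfolding p(2) m[OF x p(1)] m[OF dual_space_closed(2)[OF x] p(1)]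
      qscale_coset[OF subspace_sym_ideal] coset_eq_iff[OF subspace_sym_ideal]
    by (simp add: left_diff_distrib pscale_mult_left)
  show "m \<xi> (qscale (Sdual_ideal scaleG) c f) = qscale (Sdual_ideal scaleG) c (m \<xi> f)"
    unfolding p(2) m[OF x p(1)] qscale_coset[OF subspace_sym_ideal]
    by (subst m[OF x]) (simp_all add: pscale_mult_right pm.subspace_scale[OF subspace_free_on] p)
  assume "g \<in> Sdual scaleG"
  then obtain q where q: "q \<in> free_on (lists (dual_space scaleG))" "g = q +o Sdual_ideal scaleG"
    by (rule SdualE)
  show "m \<xi> (f + g) = m \<xi> f + m \<xi> g"
    unfolding p(2) q(2) m[OF x p(1)] m[OF x q(1)] coset_add[OF subspace_sym_ideal]
    by (subst m[OF x]) (simp_all add: distrib_left pm.subspace_add[OF subspace_free_on] p q)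
qed

lemma tensor_mult_coset:
  assumes f: "f \<in> Sdual scaleG"
  shows "tensor_mult scaleG scaleV f (p +o V_dual_rel scaleG scaleV) =
    lin_ext pscale (\<lambda>(u, \<xi>). Poly_Mapping.single
        (u, quot_mult (Sdual_ideal scaleG) (letter \<xi> +o Sdual_ideal scaleG) f) 1) p
      +o V_Sdual_rel scaleG scaleV"
  unfolding tensor_mult_def
proof (rule induced_coset_linear[OF linear_lin_ext_pscale subspace_tensor subspace_tensor])
  fix n assume "n \<in> V_dual_rel scaleG scaleV"
  then show "lin_ext pscale (\<lambda>(u, \<xi>). Poly_Mapping.single
        (u, quot_mult (Sdual_ideal scaleG) (letter \<xi> +o Sdual_ideal scaleG) f) 1) n
      \<in> V_Sdual_rel scaleG scaleV"
    by (rule tensor_relations_mapped[OF pm.vector_space_axioms subspace_tensor, rotated 4])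
      (simp_all add: tensor_relationsI Sdual_closed Sdual_mult_linear f)
qed

lemma pairing_linear:
  assumes f: "f \<in> Sdual scaleG" and s: "s \<in> sym_alg scaleG UNIV"
  shows "g \<in> Sdual scaleG \<Longrightarrow> pairing (f + g) s = pairing f s + pairing g s"
    and "pairing (qscale (Sdual_ideal scaleG) c f) s = c * pairing f s"
proof -
  obtain p where p: "p \<in> free_on (lists (dual_space scaleG))" "f = p +o Sdual_ideal scaleG"
    using f by (rule SdualE)
  obtain r where r: "s = r +o sym_ideal scaleG UNIV" using s by (auto simp: sym_alg_def)
  show "pairing (qscale (Sdual_ideal scaleG) c f) s = c * pairing f s"
    unfolding p(2) r qscale_coset[OF subspace_sym_ideal] pairing_coset[OF p(1)]
    by (simp add: pairing_coset pm.subspace_scale[OF subspace_free_on] p lin_map_scale[OF linear_free_pairing_left])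
  assume "g \<in> Sdual scaleG"
  then obtain q where q: "q \<in> free_on (lists (dual_space scaleG))" "g = q +o Sdual_ideal scaleG"
    by (rule SdualE)
  show "pairing (f + g) s = pairing f s + pairing g s"
    unfolding p(2) q(2) r coset_add[OF subspace_sym_ideal] pairing_coset[OF p(1)] pairing_coset[OF q(1)]
    by (simp add: pairing_coset pm.subspace_add[OF subspace_free_on] p q lin_map_add[OF linear_free_pairing_left])
qed

context lie_representation
begin

lemma contract_coset:
  assumes s: "s \<in> sym_alg scaleG UNIV"
  shows "contract scaleV s (p +o V_Sdual_rel scaleG scaleV) =
    lin_ext scaleV (\<lambda>(v, f). scaleV (pairing f s) v) p"
  unfolding contract_def
proof (rule induced_coset)
  note L = linear_lin_ext[OF V.vector_space_axioms]
  fix n assume "n \<in> V_Sdual_rel scaleG scaleV"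
  then have "lin_ext scaleV (\<lambda>(v, f). scaleV (pairing f s) v) n \<in> {0}"
    by (rule tensor_relations_mapped[OF V.vector_space_axioms subspace_zero[OF V.vector_space_axioms], rotated 4])
      (simp_all add: pairing_linear[OF _ s] V.scale_right_distrib V.scale_left_distrib mult.commute)
  then show "lin_ext scaleV (\<lambda>(v, f). scaleV (pairing f s) v) (p + n) =
      lin_ext scaleV (\<lambda>(v, f). scaleV (pairing f s) v) p"
    by (simp add: lin_map_add[OF L])
qed (rule pm.subspace_0[OF subspace_tensor])

abbreviation "dual_basis b \<equiv> (\<lambda>x. representation BasisG x b)"

lemma dual_basis_in_dual: "dual_basis b \<in> dual_space scaleG"
  unfolding dual_space_def Hom_def mem_Collect_eq
  by (rule linear_representation) (simp_all add: independent_Basis span_Basis)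

lemma Lambda_in_tensor:
  "Lambda scaleG BasisG scaleV rho v \<in> tensor_space scaleV (dual_space scaleG) (+) dual_scale"
  unfolding Lambda_def tensor_space_def
  by (intro imageI pm.subspace_sum[OF subspace_free_on]) (simp add: free_on_def dual_basis_in_dual)

text \<open>Evaluating the second factor of \<open>\<Lambda> v \<in> V \<otimes> g\<^sup>*\<close> at \<open>x\<close> gives \<open>rho x v\<close>.\<close>

lemma evaluate_Lambda:
  "induced (lin_ext scaleV (\<lambda>(u, \<xi>). scaleV (\<xi> x) u)) (Lambda scaleG BasisG scaleV rho v) = rho x v"
proof -
  note L = linear_lin_ext[OF V.vector_space_axioms]
  let ?F = "lin_ext scaleV (\<lambda>(u, \<xi>). scaleV (\<xi> x) u)"
  let ?p = "\<Sum>b\<in>BasisG. Poly_Mapping.single (rho b v, dual_basis b) 1"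
  have "induced ?F (?p +o V_dual_rel scaleG scaleV) = ?F ?p"
  proof (rule induced_coset)
    fix n assume "n \<in> V_dual_rel scaleG scaleV"
    then have "?F n \<in> {0}"
      by (rule tensor_relations_mapped[OF V.vector_space_axioms subspace_zero[OF V.vector_space_axioms], rotated 4])
        (simp_all add: dual_scale_def V.scale_right_distrib V.scale_left_distrib mult.commute)
    then show "?F (?p + n) = ?F ?p" by (simp add: lin_map_add[OF L])
  qed (rule pm.subspace_0[OF subspace_tensor])
  also have "?F ?p = (\<Sum>b\<in>BasisG. scaleV (representation BasisG x b) (rho b v))"
  proof -
    interpret F: Vector_Spaces.linear pscale scaleV ?F by (rule L)
    show ?thesis by (simp add: F.sum lin_ext_single[OF V.vector_space_axioms])
  qed
  also have "\<dots> = rho (\<Sum>b\<in>BasisG. scaleG (representation BasisG x b) b) v"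
  proof -
    interpret R: Vector_Spaces.linear scaleG scaleV "\<lambda>x. rho x v" by (rule rho_linear_left)
    show ?thesis by (simp add: R.sum R.scale)
  qed
  also have "(\<Sum>b\<in>BasisG. scaleG (representation BasisG x b) b) = x"
    by (rule sum_representation_eq) (simp_all add: independent_Basis span_Basis finite_Basis)
  finally show ?thesis unfolding Lambda_def .
qed

lemma Lambda_step_coset:
  assumes p: "p \<in> free_on (UNIV \<times> Sdual scaleG)"
  shows "Lambda_step scaleG BasisG scaleV rho (p +o V_Sdual_rel scaleG scaleV) =
    lin_ext pscale (\<lambda>(v, f). \<Sum>b\<in>BasisG. Poly_Mapping.single (rho b v,
        quot_mult (Sdual_ideal scaleG) (letter (dual_basis b) +o Sdual_ideal scaleG) f) 1) p
      +o V_Sdual_rel scaleG scaleV"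
    (is "_ = lin_ext pscale ?h p +o ?N")
proof -
  let ?m = "\<lambda>b. quot_mult (Sdual_ideal scaleG) (letter (dual_basis b) +o Sdual_ideal scaleG)"
  let ?F = "quot_lin_ext ?N (\<lambda>(v, f). tensor_mult scaleG scaleV f (Lambda scaleG BasisG scaleV rho v))"
  have F: "?F q = lin_ext pscale ?h q +o ?N" if "q \<in> free_on (UNIV \<times> Sdual scaleG)" for q
  proof (rule quot_lin_ext_coset[OF subspace_tensor])
    fix a assume "a \<in> Poly_Mapping.keys q"
    then obtain v f where a: "a = (v, f)" "f \<in> Sdual scaleG"
      using \<open>q \<in> free_on _\<close> by (auto simp: free_on_def)
    let ?G = "lin_ext pscale (\<lambda>(u, \<xi>). Poly_Mapping.single
        (u, quot_mult (Sdual_ideal scaleG) (letter \<xi> +o Sdual_ideal scaleG) f) (1::'k))"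
    interpret G: Vector_Spaces.linear pscale pscale ?G by (rule linear_lin_ext_pscale)
    show "(case a of (v, f) \<Rightarrow> tensor_mult scaleG scaleV f (Lambda scaleG BasisG scaleV rho v)) = ?h a +o ?N"
      by (simp add: a Lambda_def tensor_mult_coset G.sum)
  qed
  have sub: "?N \<subseteq> free_on (UNIV \<times> Sdual scaleG)"
    unfolding tensor_relations_def
    by (intro pm.span_minimal subspace_free_on)
      (auto intro!: pm.subspace_diff[OF subspace_free_on] single_in_free_on Sdual_closed)
  have "lin_ext pscale ?h n \<in> ?N" if "n \<in> ?N" for n
    using that
  proof (rule tensor_relations_mapped[OF pm.vector_space_axioms subspace_tensor, rotated 4])
    note S = pm.subspace_sum[OF subspace_tensor] tensor_relationsI Sdual_closed dual_basis_in_dual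
    fix u v f g c assume f: "f \<in> Sdual scaleG"
    show "?h (u + v, f) - ?h (u, f) - ?h (v, f) \<in> ?N"
      using f by (simp add: lin_map_add[OF rho_linear_right] flip: sum_subtractf) (intro S)
    show "?h (scaleV c v, f) - pscale c (?h (v, f)) \<in> ?N"
      using f by (simp add: lin_map_scale[OF rho_linear_right] pm.scale_sum_right flip: sum_subtractf) (intro S)
    show "?h (v, qscale (Sdual_ideal scaleG) c f) - pscale c (?h (v, f)) \<in> ?N"
      using f by (simp add: Sdual_mult_linear dual_basis_in_dual pm.scale_sum_right flip: sum_subtractf) (intro S)
    assume "g \<in> Sdual scaleG"
    then show "?h (v, f + g) - ?h (v, f) - ?h (v, g) \<in> ?N"
      using f by (simp add: Sdual_mult_linear dual_basis_in_dual flip: sum_subtractf) (intro S)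
  qed
  note h = this
  have "?F (p + n) = ?F p" if "n \<in> ?N" for n
  proof -
    have "p + n \<in> free_on (UNIV \<times> Sdual scaleG)"
      by (rule pm.subspace_add[OF subspace_free_on p subsetD[OF sub that]])
    then have "?F (p + n) = lin_ext pscale ?h (p + n) +o ?N" by (rule F)
    also have "\<dots> = lin_ext pscale ?h p +o ?N"
      unfolding coset_eq_iff[OF subspace_tensor] lin_map_add[OF linear_lin_ext_pscale] add_diff_cancel_left'
      by (rule h[OF that])
    finally show ?thesis by (simp only: F[OF p])
  qed
  then have "induced ?F (p +o ?N) = ?F p"
    by (rule induced_coset[OF pm.subspace_0[OF subspace_tensor]])
  then show ?thesis unfolding Lambda_step_def F[OF p] .
qed

end

end

theory Submission
  imports Defs
begin

text \<open>
  Symmetrization commutes with the derivations extending \<open>ad x\<close>, so \<open>PBW\<close> preserves invariants.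
  In a basis \<open>B\<close> of \<open>g\<close>, the tensor \<open>\<Lambda>\<^sup>k v\<close> is the sum over \<open>b\<^sub>1, \<dots>, b\<^sub>k \<in> B\<close> of
  \<open>rho b\<^sub>1 (\<dots> (rho b\<^sub>k v)) \<otimes> b\<^sub>1\<^sup>* \<cdots> b\<^sub>k\<^sup>*\<close>. Pairing with \<open>x\<^sub>1 \<cdots> x\<^sub>k\<close> and expanding each \<open>x\<^sub>i\<close> in the
  basis gives the sum of the values at \<open>v\<close> of the products of \<open>rho x\<^sub>1, \<dots>, rho x\<^sub>k\<close> in all orders, and the
  factor \<open>1/k!\<close> of \<open>exp(\<Lambda>)\<close> is the one in \<open>PBW\<close>.
\<close>

section \<open>Symmetrization and the derivations extending \<open>ad x\<close>\<close>

lemma permute_list_update: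
  assumes "\<sigma> permutes {..<length w}" "i < length w"
  shows "(permute_list \<sigma> w)[i := y] = permute_list \<sigma> (w[\<sigma> i := y])"
proof (rule nth_equalityI)
  fix j assume j: "j < length ((permute_list \<sigma> w)[i := y])"
  have "\<sigma> i = \<sigma> j \<longleftrightarrow> i = j" using permutes_inj[OF assms(1)] by (auto dest: injD)
  moreover have "\<sigma> i < length w" using permutes_in_image[OF assms(1), of i] assms(2) by simp
  ultimately show "(permute_list \<sigma> w)[i := y] ! j = permute_list \<sigma> (w[\<sigma> i := y]) ! j"
    using assms j by (simp add: nth_list_update permute_list_nth)
qed simp

text \<open>Slot i of the permuted word is slot \<sigma> i of \<open>w\<close>. Reindexing the slots
  by \<sigma> lets the bracket act first and the permutation afterwards.\<close>

lemma ad_word_permute_list: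
  assumes "\<sigma> permutes {..<length w}"
  shows "ad_word bracket x (permute_list \<sigma> w) =
    (\<Sum>i<length w. Poly_Mapping.single (permute_list \<sigma> (w[i := bracket x (w ! i)])) 1)"
proof -
  have "ad_word bracket x (permute_list \<sigma> w) =
      (\<Sum>i<length w. Poly_Mapping.single (permute_list \<sigma> (w[\<sigma> i := bracket x (w ! \<sigma> i)])) 1)"
    unfolding ad_word_def
    by (intro sum.cong) (simp_all add: permute_list_update assms permute_list_nth)
  also have "\<dots> = (\<Sum>i<length w. Poly_Mapping.single (permute_list \<sigma> (w[i := bracket x (w ! i)])) 1)"
    by (subst (2) sum.permute[OF assms]) (simp add: o_def)
  finally show ?thesis .
qed

lemma lin_map_sum:
  assumes "Vector_Spaces.linear s1 s2 F" shows "F (\<Sum>a\<in>A. f a) = (\<Sum>a\<in>A. F (f a))"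
proof -
  interpret Vector_Spaces.linear s1 s2 F by fact
  show ?thesis by (rule sum)
qed

lemma linear_lin_ext_comp:
  assumes "Vector_Spaces.linear pscale scale F"
  shows "F (lin_ext pscale f p) = lin_ext scale (\<lambda>a. F (f a)) p"
  unfolding lin_ext_def by (simp add: lin_map_sum[OF assms] lin_map_scale[OF assms])

text \<open>The sum over permutations and the sum over slots are interchanged; the derivation keeps
  the length of words, so the normalizing factorial is the same on both sides.\<close>

lemma ad_symmetrize:
  "lin_ext pscale (ad_word bracket x) (symmetrize w) =
    lin_ext pscale symmetrize (ad_word bracket x w :: 'g list \<Rightarrow>\<^sub>0 'k::field_char_0)"
proof -
  note L = lin_map_sum[OF linear_lin_ext_pscale] lin_map_scale[OF linear_lin_ext_pscale]
  let ?P = "{\<sigma>. \<sigma> permutes {..<length w}}"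
  have "lin_ext pscale (ad_word bracket x) (symmetrize w) = pscale (1 / fact (length w))
      (\<Sum>\<sigma>\<in>?P. \<Sum>i<length w.
        Poly_Mapping.single (permute_list \<sigma> (w[i := bracket x (w ! i)])) (1::'k))"
    by (simp add: symmetrize_def L ad_word_permute_list)
  also have "\<dots> = (\<Sum>i<length w. symmetrize (w[i := bracket x (w ! i)]))"
    by (subst sum.swap) (simp add: symmetrize_def pm.scale_sum_right)
  also have "\<dots> = lin_ext pscale symmetrize (ad_word bracket x w)"
    by (simp add: ad_word_def[of _ _ w] L)
  finally show ?thesis .
qed

lemma ad_lin_ext_symmetrize:
  "lin_ext pscale (ad_word bracket x) (lin_ext pscale symmetrize p) =
    lin_ext pscale symmetrize (lin_ext pscale (ad_word bracket x) p)"
  by (simp add: linear_lin_ext_comp[OF linear_lin_ext_pscale] ad_symmetrize)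

lemma (in lie_algebra) PBW_invariant:
  assumes "s \<in> sym_invariants scaleG bracket"
  shows "PBW scaleG bracket s \<in> env_invariants scaleG bracket"
proof -
  obtain p where p: "s = p +o sym_ideal scaleG UNIV"
    using assms by (auto simp: sym_invariants_def sym_alg_def)
  have "lin_ext pscale (ad_word bracket x) (lin_ext pscale symmetrize p) \<in> env_ideal scaleG bracket" for x
  proof -
    \<comment> \<open>The zero of the quotient has to stay in the form \<open>0 +o N\<close> for
      \<open>coset_eq_iff\<close> to apply, so \<open>set_zero_plus\<close> is removed from the
      simplifier.\<close>
    have "lin_ext pscale (ad_word bracket x) p \<in> sym_ideal scaleG UNIV"
      using assms by (simp add: p sym_invariants_def ad_action_sym_coset
          coset_eq_iff[OF subspace_sym_ideal] del: set_zero_plus)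
    then show ?thesis
      unfolding ad_lin_ext_symmetrize by (rule symmetrize_sym_ideal)
  qed
  moreover have "PBW scaleG bracket s \<in> env_alg scaleG bracket"
    unfolding p PBW_coset env_alg_def by (rule rangeI)
  ultimately show ?thesis
    by (simp add: p PBW_coset env_invariants_def ad_action_env_coset
        coset_eq_iff[OF subspace_env_ideal] del: set_zero_plus)
qed

section \<open>Words in a basis and the iterates of \<open>Lambda\<close>\<close>

abbreviation words :: "'a set \<Rightarrow> nat \<Rightarrow> 'a list set"
  where "words A k \<equiv> {xs. set xs \<subseteq> A \<and> length xs = k}"

lemma sum_words_Suc:
  "(\<Sum>xs\<in>words A (Suc k). f xs) = (\<Sum>xs\<in>words A k. \<Sum>x\<in>A. f (x # xs))"
proof -
  have "(\<Sum>xs\<in>words A (Suc k). f xs) = (\<Sum>(xs, x)\<in>words A k \<times> A. f (x # xs))"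
    unfolding lists_length_Suc_eq
    by (subst sum.reindex) (auto simp: inj_on_def case_prod_unfold)
  then show ?thesis by (simp add: sum.cartesian_product)
qed

context lie_representation
begin

lemma env_act_linear:
  assumes "u \<in> env_alg scaleG bracket"
  shows "env_act scaleV rho u \<in> Hom scaleV scaleV"
proof -
  obtain p where p: "u = p +o env_ideal scaleG bracket" using assms by (auto simp: env_alg_def)
  show ?thesis
    unfolding Hom_def mem_Collect_eq p env_act_coset Vector_Spaces.linear_iff lin_ext_def
    by (simp add: V.vector_space_axioms lin_map_add[OF linear_foldr_rho]
        lin_map_scale[OF linear_foldr_rho] V.scale_right_distrib sum.distrib V.scale_sum_right
        mult.commute)
qed

abbreviation "dual_word bs \<equiv> Poly_Mapping.single (map dual_basis bs) (1::'k)"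

lemma dual_word_in_free: "dual_word bs \<in> free_on (lists (dual_space scaleG))"
  by (rule single_in_free_on) (auto simp: dual_basis_in_dual)

text \<open>Induction on k: a further \<open>Lambda_step\<close> puts \<open>rho b\<close> in front
  of the operators and \<open>dual_basis b\<close> in front of the monomial, so one word
  \<open>b # bs\<close> records both.\<close>

lemma Lambda_power_eq:
  "Lambda_power scaleG BasisG scaleV rho k v =
    (\<Sum>bs\<in>words BasisG k. Poly_Mapping.single (foldr rho bs v, dual_word bs +o Sdual_ideal scaleG) 1)
      +o V_Sdual_rel scaleG scaleV"
proof (induction k)
  case 0
  have "words BasisG 0 = {[]}" by auto
  then show ?case by (simp add: Lambda_power_def one_poly_mapping_list)
next
  case (Suc k)
  let ?p = "\<Sum>bs\<in>words BasisG k. Poly_Mapping.single (foldr rho bs v, dual_word bs +o Sdual_ideal scaleG) (1::'k)"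
  \<comment> \<open>\<open>Lambda_step_coset\<close> evaluates the step only on representatives
    whose second factors lie in \<open>Sdual scaleG\<close>.\<close>
  have p: "?p \<in> free_on (UNIV \<times> Sdual scaleG)"
    by (intro pm.subspace_sum[OF subspace_free_on] single_in_free_on)
      (simp add: SdualI dual_word_in_free)
  have m: "quot_mult (Sdual_ideal scaleG) (letter (dual_basis b) +o Sdual_ideal scaleG)
      (dual_word bs +o Sdual_ideal scaleG) = dual_word (b # bs) +o Sdual_ideal scaleG" for b bs
    by (subst Sdual_mult) (simp_all add: letter_dual dual_basis_in_dual dual_word_in_free, simp add: letter_def)
  have "Lambda_power scaleG BasisG scaleV rho (Suc k) v =
      Lambda_step scaleG BasisG scaleV rho (?p +o V_Sdual_rel scaleG scaleV)"
    using Suc by (simp add: Lambda_power_def)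
  also have "\<dots> = (\<Sum>bs\<in>words BasisG k. \<Sum>b\<in>BasisG.
      Poly_Mapping.single (foldr rho (b # bs) v, dual_word (b # bs) +o Sdual_ideal scaleG) 1)
        +o V_Sdual_rel scaleG scaleV"
    unfolding Lambda_step_coset[OF p]
    by (simp add: lin_map_sum[OF linear_lin_ext_pscale] m del: list.map)
  finally show ?case by (simp only: sum_words_Suc)
qed

section \<open>Basis expansion, pairing and contraction\<close>

lemma rho_basis_expansion:
  "(\<Sum>b\<in>BasisG. scaleV (dual_basis b x) (rho b v)) = rho x v"
proof -
  have "rho x v = rho (\<Sum>b\<in>BasisG. scaleG (dual_basis b x) b) v"
    by (simp add: sum_representation_eq independent_Basis span_Basis finite_Basis)
  then show ?thesis
    by (simp add: lin_map_sum[OF rho_linear_left] lin_map_scale[OF rho_linear_left])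
qed

text \<open>The product of operators is multilinear in the letters, so all letters can be expanded
  in the basis at once.\<close>

lemma foldr_rho_basis_expansion:
  "(\<Sum>bs\<in>words BasisG (length xs). scaleV (\<Prod>i<length xs. dual_basis (bs ! i) (xs ! i)) (foldr rho bs v))
    = foldr rho xs v"
proof (induction xs)
  case Nil
  have "words BasisG 0 = {[]}" by auto
  then show ?case by simp
next
  case (Cons x xs)
  have "(\<Sum>bs\<in>words BasisG (length xs). \<Sum>b\<in>BasisG.
      scaleV (dual_basis b x * (\<Prod>i<length xs. dual_basis (bs ! i) (xs ! i))) (rho b (foldr rho bs v))) =
    (\<Sum>b\<in>BasisG. scaleV (dual_basis b x) (rho b (foldr rho xs v)))"
    \<comment> \<open>Linearity of \<open>rho b\<close> in the vector lets it pass through the sum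
      over the tails.\<close>
    unfolding Cons.IH[symmetric]
    by (subst sum.swap) (simp add: lin_map_sum[OF rho_linear_right] lin_map_scale[OF rho_linear_right]
        V.scale_sum_right)
  \<comment> \<open>The factor of index 0 is split off the product, not the last one, since the new
    letter stands in front.\<close>
  then show ?case
    by (simp add: sum_words_Suc prod.lessThan_Suc_shift rho_basis_expansion del: prod.lessThan_Suc)
qed

text \<open>The \<sigma>-term of the pairing is the coefficient product in the expansion of the word
  permuted by \<sigma>. In unequal lengths the pairing is zero by definition.\<close>

lemma word_pairing_basis_expansion:
  "(\<Sum>bs\<in>words BasisG k. scaleV (word_pairing (map dual_basis bs) w) (foldr rho bs v)) =
    (if length w = k then \<Sum>\<sigma> | \<sigma> permutes {..<length w}. foldr rho (permute_list \<sigma> w) v else 0)"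
proof (cases "length w = k")
  case True
  have "(\<Sum>bs\<in>words BasisG k. scaleV (word_pairing (map dual_basis bs) w) (foldr rho bs v)) =
      (\<Sum>bs\<in>words BasisG k. \<Sum>\<sigma> | \<sigma> permutes {..<length w}.
        scaleV (\<Prod>i<length w. dual_basis (bs ! i) (permute_list \<sigma> w ! i)) (foldr rho bs v))"
    using True by (intro sum.cong) (simp_all add: word_pairing_def V.scale_sum_left permute_list_nth)
  also have "\<dots> = (\<Sum>\<sigma> | \<sigma> permutes {..<length w}. foldr rho (permute_list \<sigma> w) v)"
    using True foldr_rho_basis_expansion[of "permute_list _ w"] by (subst sum.swap) simp
  finally show ?thesis using True by simp
qed (auto simp: word_pairing_def intro!: sum.neutral)

text \<open>The degree k part of an element is read off from any representative by keeping its words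
  of length k; on these the factor 1/k! of the exponential is the one in
  \<open>symmetrize\<close>.\<close>

lemma contract_exp_Lambda_degree:
  "contract scaleV (p +o sym_ideal scaleG UNIV) (exp_Lambda scaleG BasisG scaleV rho k v) =
    (\<Sum>w\<in>Poly_Mapping.keys p. if length w = k
      then scaleV (Poly_Mapping.lookup p w) (lin_ext scaleV (\<lambda>w. foldr rho w v) (symmetrize w)) else 0)"
proof -
  note LV = linear_lin_ext[OF V.vector_space_axioms]
  have s: "p +o sym_ideal scaleG UNIV \<in> sym_alg scaleG UNIV"
    by (auto simp: sym_alg_def free_on_def)
  have pair: "pairing (dual_word bs +o Sdual_ideal scaleG) (p +o sym_ideal scaleG UNIV) =
      (\<Sum>w\<in>Poly_Mapping.keys p. Poly_Mapping.lookup p w * word_pairing (map dual_basis bs) w)" for bs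
    by (simp add: pairing_coset[OF dual_word_in_free] free_pairing_def
        lin_ext_single[OF vector_space_field]) (simp add: lin_ext_def)
  have sym: "lin_ext scaleV (\<lambda>w. foldr rho w v) (symmetrize w) = scaleV (1 / fact (length w))
      (\<Sum>\<sigma> | \<sigma> permutes {..<length w}. foldr rho (permute_list \<sigma> w) v)" for w :: "'g list"
    by (simp add: symmetrize_def lin_map_scale[OF LV] lin_map_sum[OF LV] lin_ext_single[OF V.vector_space_axioms])
  have "contract scaleV (p +o sym_ideal scaleG UNIV) (exp_Lambda scaleG BasisG scaleV rho k v) =
      scaleV (1 / fact k) (\<Sum>bs\<in>words BasisG k.
        scaleV (\<Sum>w\<in>Poly_Mapping.keys p. Poly_Mapping.lookup p w * word_pairing (map dual_basis bs) w)
          (foldr rho bs v))"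
    unfolding exp_Lambda_def Lambda_power_eq qscale_coset[OF subspace_tensor] contract_coset[OF s]
      lin_map_scale[OF LV] lin_map_sum[OF LV]
    by (simp add: lin_ext_single[OF V.vector_space_axioms] pair)
  also have "\<dots> = scaleV (1 / fact k) (\<Sum>w\<in>Poly_Mapping.keys p. scaleV (Poly_Mapping.lookup p w)
      (\<Sum>bs\<in>words BasisG k. scaleV (word_pairing (map dual_basis bs) w) (foldr rho bs v)))"
    unfolding V.scale_sum_left by (subst sum.swap) (simp add: V.scale_sum_right)
  also have "\<dots> = (\<Sum>w\<in>Poly_Mapping.keys p. if length w = k
      then scaleV (Poly_Mapping.lookup p w) (lin_ext scaleV (\<lambda>w. foldr rho w v) (symmetrize w)) else 0)"
    unfolding word_pairing_basis_expansion V.scale_sum_right[of "1 / fact k"]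
    by (intro sum.cong refl) (simp add: sym mult.commute)
  finally show ?thesis .
qed

lemma env_act_PBW:
  assumes "s \<in> sym_alg scaleG UNIV"
  shows "env_act scaleV rho (PBW scaleG bracket s) = contract_exp_Lambda scaleG BasisG scaleV rho s"
proof
  fix v
  obtain p where p: "s = p +o sym_ideal scaleG UNIV" using assms by (auto simp: sym_alg_def)
  let ?K = "Poly_Mapping.keys p"
  let ?f = "\<lambda>w. scaleV (Poly_Mapping.lookup p w) (lin_ext scaleV (\<lambda>w. foldr rho w v) (symmetrize w))"
  have "contract_exp_Lambda scaleG BasisG scaleV rho s v =
      Sum_any (\<lambda>k. \<Sum>w\<in>?K. if length w = k then ?f w else 0)"
    by (simp add: contract_exp_Lambda_def p contract_exp_Lambda_degree)
  \<comment> \<open>A degree that is not the length of a word of \<open>p\<close> contributes zero,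
    so the support of the sum is finite.\<close>
  also have "\<dots> = (\<Sum>k\<in>length ` ?K. \<Sum>w\<in>?K. if length w = k then ?f w else 0)"
    by (rule Sum_any.expand_superset) (auto elim!: sum.not_neutral_contains_not_neutral split: if_splits)
  \<comment> \<open>Each word is counted once, in the degree equal to its length.\<close>
  also have "\<dots> = (\<Sum>w\<in>?K. ?f w)"
    by (subst sum.swap) simp
  also have "\<dots> = env_act scaleV rho (PBW scaleG bracket s) v"
    unfolding p PBW_coset env_act_coset linear_lin_ext_comp[OF linear_lin_ext[OF V.vector_space_axioms]]
    by (simp add: lin_ext_def[of _ _ p])
  finally show "env_act scaleV rho (PBW scaleG bracket s) v =
      contract_exp_Lambda scaleG BasisG scaleV rho s v" ..
qed

end

theorem mainTheorem3:
  fixes scaleG :: "'k::field_char_0 \<Rightarrow> 'g::ab_group_add \<Rightarrow> 'g" and BasisG :: "'g set"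
    and bracket :: "'g \<Rightarrow> 'g \<Rightarrow> 'g"
    and scaleV :: "'k \<Rightarrow> 'v::ab_group_add \<Rightarrow> 'v" and BasisV :: "'v set"
    and rho :: "'g \<Rightarrow> 'v \<Rightarrow> 'v"
  assumes "lie_representation scaleG BasisG bracket scaleV BasisV rho"
  shows "PBW scaleG bracket \<in> sym_invariants scaleG bracket \<rightarrow> env_invariants scaleG bracket \<and>
    env_act scaleV rho \<in> env_invariants scaleG bracket \<rightarrow> Hom scaleV scaleV \<and>
    contract_exp_Lambda scaleG BasisG scaleV rho \<in>
      sym_invariants scaleG bracket \<rightarrow> Hom scaleV scaleV \<and>
    (\<forall>s \<in> sym_invariants scaleG bracket.
      env_act scaleV rho (PBW scaleG bracket s) = contract_exp_Lambda scaleG BasisG scaleV rho s)"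
proof -
  interpret lie_representation scaleG BasisG bracket scaleV BasisV rho by fact
  have act: "env_act scaleV rho u \<in> Hom scaleV scaleV" if "u \<in> env_invariants scaleG bracket" for u
    using that by (auto simp: env_invariants_def intro: env_act_linear)
  have comm: "env_act scaleV rho (PBW scaleG bracket s) = contract_exp_Lambda scaleG BasisG scaleV rho s"
    if "s \<in> sym_invariants scaleG bracket" for s
    using that by (auto simp: sym_invariants_def intro: env_act_PBW)
  \<comment> \<open>That contraction lands in \<open>Hom\<close> follows from the other claims: on
    invariants it is the composite of \<open>PBW\<close> and the action.\<close>
  show ?thesis
    using PBW_invariant act comm by (metis Pi_I)
qed

end
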